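(* Let $p$ be a prime, let $q$ be a power of $p$, and let $H\le N(2,q)$ be a cube-free primitive subgroup of order $m$, where $p\nmid m$. Let $N_{pr}(m,H)$ be the number of conjugacy classes of primitive subgroups of $\mathrm{GL}(2,q)$ of order $m$ that are isomorphic to $H$. Then $N_{pr}(m,H)=1$.
   Context: $\mathbb{F}_q$ is the finite field of order $q$. $S(2,q)\cong\mathbb{Z}_{q^2-1}$ denotes a Singer cycle of $\mathrm{GL}(2,q)=\mathrm{GL}(2,\mathbb{F}_q)$, i.e. a (fixed) cyclic subgroup of order $q^2-1$, and $N(2,q)$ is the normaliser of $S(2,q)$ in $\mathrm{GL}(2,q)$. A group is cube-free if its order is not divisible by the cube of any prime. A subgroup $K\le\mathrm{GL}(2,q)$ is irreducible if it leaves no one-dimensional subspace of $V=\mathbb{F}_q^2$ invariant; an irreducible $K$ is imprimitive if $V=V_1\oplus V_2$ for some one-dimensional subspaces $V_1,V_2$ permuted by $K$, and primitive otherwise. Conjugacy classes of subgroups are taken with respect to conjugation in $\mathrm{GL}(2,q)$. *)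

theory Defs
  imports "HOL-Analysis.Analysis" "HOL-Computational_Algebra.Primes"
    "HOL-Algebra.Elementary_Groups" "HOL-Algebra.Group_Action"
begin

definition GL2 :: "('a::field^2^2) monoid" where
  "GL2 = \<lparr>carrier = {A. invertible A}, monoid.mult = (**), one = mat 1\<rparr>"

lemma group_GL2: "group (GL2 :: ('a::field^2^2) monoid)"
proof (rule groupI)
  fix A :: "'a^2^2"
  assume "A \<in> carrier GL2"
  then obtain B where "A ** B = mat 1" "B ** A = mat 1"
    by (auto simp: GL2_def invertible_def)
  then show "\<exists>B\<in>carrier GL2. B \<otimes>\<^bsub>GL2\<^esub> A = \<one>\<^bsub>GL2\<^esub>"
    by (auto simp: GL2_def invertible_def)
next
  show "\<one>\<^bsub>GL2\<^esub> \<in> carrier (GL2 :: ('a^2^2) monoid)"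
    by (auto simp: GL2_def invertible_def intro: exI[of _ "mat 1"])
qed (simp_all add: GL2_def invertible_mult matrix_mul_assoc)

text \<open>Every cyclic subgroup of order $q^2 - 1$ is a Singer cycle; here $q$ is the order of the
  underlying field.\<close>

definition singer_cycle :: "('a::{field,finite}^2^2) set \<Rightarrow> bool" where
  "singer_cycle S \<longleftrightarrow>
     subgroup S GL2 \<and> cyclic_group (GL2\<lparr>carrier := S\<rparr>) \<and> card S = CARD('a)\<^sup>2 - 1"

definition cube_free_group :: "('a, 'b) monoid_scheme \<Rightarrow> bool" where
  "cube_free_group G \<longleftrightarrow> (\<forall>r::nat. prime r \<longrightarrow> \<not> r ^ 3 dvd card (carrier G))"

definition one_dim_subspace :: "('a::field^2) set \<Rightarrow> bool" where
  "one_dim_subspace W \<longleftrightarrow> vec.subspace W \<and> vec.dim W = 1"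

definition irreducible_subgroup :: "('a::field^2^2) set \<Rightarrow> bool" where
  "irreducible_subgroup K \<longleftrightarrow>
     subgroup K GL2 \<and> \<not> (\<exists>W. one_dim_subspace W \<and> (\<forall>A\<in>K. (*v) A ` W \<subseteq> W))"

definition internal_direct_sum :: "('a::field^2) set \<Rightarrow> ('a^2) set \<Rightarrow> bool" where
  "internal_direct_sum V1 V2 \<longleftrightarrow> V1 \<inter> V2 = {0} \<and> {x + y | x y. x \<in> V1 \<and> y \<in> V2} = UNIV"

definition imprimitive_subgroup :: "('a::field^2^2) set \<Rightarrow> bool" where
  "imprimitive_subgroup K \<longleftrightarrow> irreducible_subgroup K \<and>
     (\<exists>V1 V2. one_dim_subspace V1 \<and> one_dim_subspace V2 \<and> internal_direct_sum V1 V2 \<and>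
        (\<forall>A\<in>K. (`) ((*v) A) ` {V1, V2} = {V1, V2}))"

definition primitive_subgroup :: "('a::field^2^2) set \<Rightarrow> bool" where
  "primitive_subgroup K \<longleftrightarrow> irreducible_subgroup K \<and> \<not> imprimitive_subgroup K"

definition conj_subgroup :: "'a::field^2^2 \<Rightarrow> ('a^2^2) set \<Rightarrow> ('a^2^2) set" where
  "conj_subgroup g K = g <#\<^bsub>GL2\<^esub> K #>\<^bsub>GL2\<^esub> inv\<^bsub>GL2\<^esub> g"

definition N_pr :: "nat \<Rightarrow> ('a::field^2^2) set \<Rightarrow> nat" where
  "N_pr m H = card (orbits GL2
     {K :: ('a^2^2) set. primitive_subgroup K \<and> card K = m \<and> GL2\<lparr>carrier := K\<rparr> \<cong> GL2\<lparr>carrier := H\<rparr>}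
     conj_subgroup)"

end

theory Submission
  imports Defs "HOL-Algebra.Multiplicative_Group"
begin

text \<open>
  The Singer cycle \<open>S\<close> is the unit group of a field: if \<open>g\<close> generates \<open>S\<close>, then the algebra
  \<open>alg g\<close> of all matrices \<open>x + y g\<close> is a quadratic extension \<open>E\<close> of the base field \<open>F\<close> and
  \<open>S = E - {0}\<close> (\<open>singer_cycle_alg\<close>). For matrices of size two the conjugation of \<open>E\<close> over \<open>F\<close> is
  the adjugate \<open>adj2\<close> and the norm is the determinant. An element of the normaliser of \<open>S\<close> acts on
  \<open>E\<close> by conjugation of matrices as a field automorphism, so it lies in \<open>S\<close> or is semilinear over
  \<open>E\<close> (\<open>normalizer_semilinear\<close>).

  Let \<open>K\<close> be a primitive group isomorphic to \<open>H\<close>. Two facts move abelian parts of \<open>K\<close>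
  into \<open>S\<close>. First, a nonscalar element of a normal abelian subgroup of a primitive group has no
  eigenvalue in \<open>F\<close>, since otherwise its one or two eigenlines would be permuted by the whole group
  (\<open>normal_abelian_subgroup_anisotropic\<close>). Secondly, every irreducible quadratic polynomial over
  \<open>F\<close> is the characteristic polynomial of an element of \<open>E\<close> (\<open>alg_realises_invariants\<close>), and two
  matrices with the same irreducible characteristic polynomial are conjugate. Hence a normal abelian
  subgroup of \<open>K\<close> with a nonscalar element is conjugate to a subgroup of \<open>S\<close>, and this subgroup is
  determined by its order because \<open>S\<close> is cyclic. If \<open>H\<close> is abelian, this applies to \<open>H\<close> and to \<open>K\<close>
  themselves and they are conjugate.

  Suppose that \<open>H\<close> is not abelian, and let \<open>A = H \<inter> S\<close>, which has index two in \<open>H\<close> and is not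
  contained in the scalars. After conjugation of \<open>K\<close> the isomorphism maps \<open>A\<close> onto \<open>A\<close>. Since \<open>8\<close>
  does not divide the order of the cube-free group \<open>H\<close>, some \<open>s\<close> in \<open>H - A\<close> satisfies
  \<open>s ^ 4 = 1\<close>. Let \<open>t\<close> be its image. Both \<open>s ^ 2\<close> and \<open>t ^ 2\<close> are square roots of \<open>1\<close> in the field
  \<open>E\<close>, they have the same order, and so they are equal. Both \<open>s\<close> and \<open>t\<close> are semilinear, so
  \<open>t = s e\<close> for some \<open>e\<close> in \<open>E\<close>, and \<open>t ^ 2 = s ^ 2\<close> says that \<open>e\<close> has norm one. By Hilbert's
  Theorem 90 (\<open>hilbert_90\<close>) \<open>e\<close> is the quotient of the conjugate of some \<open>y\<close> by \<open>y\<close>, which means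
  that \<open>y\<close> conjugates \<open>s\<close> to \<open>t\<close>. As \<open>y\<close> centralises \<open>A\<close>, it conjugates \<open>H\<close> to
  \<open>K\<close> (\<open>embedding_image_conjugate\<close>).
\<close>

section \<open>Matrices of size two\<close>

lemma mult2_nth: "(A ** B)$i$j = A$i$1 * B$1$j + A$i$2 * B$2$j"
  for A B :: "'a::semiring_1^2^2"
  by (simp add: matrix_matrix_mult_def sum_2)

lemma mat2_nth:
  "(mat c :: 'a::zero^2^2)$1$1 = c" "(mat c :: 'a^2^2)$2$2 = c"
  "(mat c :: 'a^2^2)$1$2 = 0" "(mat c :: 'a^2^2)$2$1 = 0"
  by (simp_all add: mat_def)

lemma trace_2: "trace A = A$1$1 + A$2$2" for A :: "'a::semiring_1^2^2"
  by (simp add: trace_def sum_2)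

lemmas mat2_simps = vec_eq_iff forall_2 mult2_nth mat2_nth det_2 trace_2

text \<open>The adjugate. On the algebra generated by a matrix it is the conjugation that swaps the two
  roots of a characteristic polynomial.\<close>
definition adj2 :: "'a::field^2^2 \<Rightarrow> 'a^2^2" where
  "adj2 A = mat (trace A) - A"

definition scalar2 :: "'a::field^2^2 \<Rightarrow> bool" where
  "scalar2 A \<longleftrightarrow> (\<exists>c. A = mat c)"

text \<open>No eigenvalue in the base field. Then the determinant is an anisotropic quadratic form on
  the span of \<^term>\<open>mat 1\<close> and \<^term>\<open>A\<close>, which is therefore a field.\<close>
definition anisotropic :: "'a::field^2^2 \<Rightarrow> bool" where
  "anisotropic A \<longleftrightarrow> (\<forall>c. det (A - mat c) \<noteq> 0)"

text \<open>The algebra generated by \<^term>\<open>A\<close>; by the Cayley-Hamilton theorem linear expressions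
  suffice.\<close>
definition alg :: "'a::field^2^2 \<Rightarrow> ('a^2^2) set" where
  "alg A = {mat x + mat y ** A | x y. True}"

lemma adj2_adj2: "adj2 (adj2 A) = A"
  by (simp add: adj2_def mat2_simps)

lemma scalar2_iff: "scalar2 A \<longleftrightarrow> A$1$2 = 0 \<and> A$2$1 = 0 \<and> A$1$1 = A$2$2"
  by (auto simp: scalar2_def mat2_simps)

lemma mult_adj2: "A ** adj2 A = mat (det A)" "adj2 A ** A = mat (det A)"
  by (simp_all add: adj2_def mat2_simps algebra_simps)

lemma cayley_hamilton2: "A ** A = mat (trace A) ** A - mat (det A)"
  for A :: "'a::field^2^2"
  by (simp add: mat2_simps algebra_simps)

lemma det_minus_mat: "det (A - mat c) = c\<^sup>2 - trace A * c + det A"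
  for A :: "'a::field^2^2"
  by (simp add: mat2_simps algebra_simps power2_eq_square)

lemma similar_invariants:
  fixes A B P :: "'a::field^2^2"
  assumes "invertible P" "P ** A = B ** P"
  shows "trace A = trace B" "det A = det B"
proof -
  obtain Q where Q: "P ** Q = mat 1" "Q ** P = mat 1"
    using assms(1) by (auto simp: invertible_def)
  have B: "B = P ** A ** Q"
    by (simp add: assms(2) Q flip: matrix_mul_assoc)
  have "trace B = trace (Q ** (P ** A))"
    unfolding B by (rule trace_mul_sym)
  then show "trace A = trace B"
    by (simp add: matrix_mul_assoc Q)
  have "det P * det A = det B * det P"
    using assms(2) by (metis det_mul)
  then show "det A = det B"
    using assms(1) by (simp add: invertible_det_nz)
qed

lemma anisotropic_not_scalar: "anisotropic A \<Longrightarrow> \<not> scalar2 A"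
  by (auto simp: anisotropic_def scalar2_def mat2_simps)

section \<open>The quadratic algebra generated by a matrix\<close>

lemma alg_commute:
  assumes "X \<in> alg A" "Y \<in> alg A" shows "X ** Y = Y ** X"
  using assms unfolding alg_def by (auto simp: mat2_simps algebra_simps)

text \<open>A nonscalar matrix of size two is cyclic, so its centraliser is the algebra it generates. In
  coordinates, commuting says that the traceless parts of \<^term>\<open>X\<close> and \<^term>\<open>A\<close> are
  proportional.\<close>
lemma commuting_imp_alg:
  fixes A X :: "'a::field^2^2"
  assumes "\<not> scalar2 A" "X ** A = A ** X"
  shows "X \<in> alg A"
proof -
  have c: "(X ** A)$i$j = (A ** X)$i$j" for i j
    using assms(2) by simp
  have e: "X$1$2 * A$2$1 = A$1$2 * X$2$1"
    "X$1$1 * A$1$2 + X$1$2 * A$2$2 = A$1$1 * X$1$2 + A$1$2 * X$2$2"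
    "X$2$1 * A$1$1 + X$2$2 * A$2$1 = A$2$1 * X$1$1 + A$2$2 * X$2$1"
    using c[of 1 1] c[of 1 2] c[of 2 1] by (simp_all add: mult2_nth mult.commute)
  have "\<exists>y. X$1$2 = y * A$1$2 \<and> X$2$1 = y * A$2$1 \<and> X$1$1 - X$2$2 = y * (A$1$1 - A$2$2)"
  proof (cases "A$1$2 = 0")
    case False
    have "X$2$1 = X$1$2 / A$1$2 * A$2$1" "X$1$1 - X$2$2 = X$1$2 / A$1$2 * (A$1$1 - A$2$2)"
      using e(1,2) False by (simp_all add: field_simps)
    then show ?thesis using False
      by (intro exI[of _ "X$1$2 / A$1$2"]) simp
  next
    case t: True
    show ?thesis
    proof (cases "A$2$1 = 0")
      case False
      have "X$1$2 = 0" using e(1) t False by simp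
      moreover have "X$1$1 - X$2$2 = X$2$1 / A$2$1 * (A$1$1 - A$2$2)"
        using e(3) False by (simp add: field_simps)
      ultimately show ?thesis using False t
        by (intro exI[of _ "X$2$1 / A$2$1"]) simp
    next
      case True
      then have n: "A$1$1 - A$2$2 \<noteq> 0" using assms(1) t by (auto simp: scalar2_iff)
      have "X$1$2 * (A$1$1 - A$2$2) = 0" "X$2$1 * (A$1$1 - A$2$2) = 0"
        using e(2,3) t True by (auto simp: algebra_simps)
      then have "X$1$2 = 0" "X$2$1 = 0" using n by (metis mult_eq_0_iff)+
      then show ?thesis using n t True
        by (intro exI[of _ "(X$1$1 - X$2$2) / (A$1$1 - A$2$2)"]) simp
    qed
  qed
  then obtain y where y: "X$1$2 = y * A$1$2" "X$2$1 = y * A$2$1"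
    "X$1$1 - X$2$2 = y * (A$1$1 - A$2$2)" by blast
  have "X = mat (X$1$1 - y * A$1$1) + mat y ** A"
    using y by (simp add: mat2_simps algebra_simps)
  then show ?thesis unfolding alg_def by blast
qed

lemma alg_self: "A \<in> alg A"
proof -
  have "A = mat 0 + mat 1 ** A" by (simp add: mat2_simps)
  then show ?thesis unfolding alg_def by blast
qed

lemma mat_in_alg: "mat c \<in> alg A"
proof -
  have "mat c = mat c + mat 0 ** A" by (simp add: mat2_simps)
  then show ?thesis unfolding alg_def by blast
qed

lemma
  assumes "X \<in> alg A" "Y \<in> alg A"
  shows alg_diff: "X - Y \<in> alg A" and alg_add: "X + Y \<in> alg A" and alg_mult: "X ** Y \<in> alg A"
proof -
  obtain a b c d where X: "X = mat a + mat b ** A" and Y: "Y = mat c + mat d ** A"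
    using assms by (auto simp: alg_def)
  have "X + Y = mat (a + c) + mat (b + d) ** A" "X - Y = mat (a - c) + mat (b - d) ** A"
    "X ** Y = mat (a * c - b * d * det A) + mat (a * d + b * c + b * d * trace A) ** A"
    by (simp_all add: X Y mat2_simps algebra_simps)
  then show "X + Y \<in> alg A" "X - Y \<in> alg A" "X ** Y \<in> alg A"
    unfolding alg_def by blast+
qed

lemma alg_adj2: "X \<in> alg A \<Longrightarrow> adj2 X \<in> alg A"
  unfolding adj2_def by (intro alg_diff mat_in_alg)

lemma alg_det_nonzero:
  assumes "anisotropic A" "X \<in> alg A" "X \<noteq> 0"
  shows "det X \<noteq> 0"
proof -
  obtain x y where X: "X = mat x + mat y ** A"
    using assms by (auto simp: alg_def)
  show ?thesis
  proof (cases "y = 0")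
    case True
    then show ?thesis using assms(3) by (simp add: X mat2_simps)
  next
    case False
    then have "X = mat y ** (A - mat (- x / y))"
      by (simp add: X mat2_simps field_simps)
    moreover have "det (mat y :: 'a^2^2) \<noteq> 0" using False by (simp add: mat2_simps)
    ultimately show ?thesis using assms(1) by (simp add: det_mul anisotropic_def)
  qed
qed

lemma alg_integral:
  assumes "anisotropic A" "X \<in> alg A" "Y \<in> alg A" "X ** Y = 0"
  shows "X = 0 \<or> Y = 0"
proof -
  have "det X * det Y = 0"
    using det_mul[of X Y] by (simp add: assms(4) det_2)
  then show ?thesis using alg_det_nonzero[OF assms(1)] assms(2,3) by auto
qed

text \<open>Both elements are roots of the same quadratic polynomial \<open>(T - X) (T - adj2 X)\<close> in a
  field.\<close>
lemma alg_eq_or_adj2: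
  assumes "anisotropic A" "X \<in> alg A" "Y \<in> alg A" "trace X = trace Y" "det X = det Y"
  shows "Y = X \<or> Y = adj2 X"
proof -
  have c: "X ** Y = Y ** X" using alg_commute assms(2,3) .
  have "(Y - X) ** (Y - adj2 X) = Y ** Y - mat (trace X) ** Y + mat (det X) + (Y ** X - X ** Y)"
    by (simp add: adj2_def mat2_simps algebra_simps)
  also have "\<dots> = 0"
    by (simp add: c assms(4,5) cayley_hamilton2)
  finally have "(Y - X) ** (Y - adj2 X) = 0" .
  then have "Y - X = 0 \<or> Y - adj2 X = 0"
    using alg_integral[OF assms(1) alg_diff alg_diff] assms(2,3) alg_adj2 by blast
  then show ?thesis by auto
qed

lemma alg_subset: "X \<in> alg A \<Longrightarrow> alg X \<subseteq> alg A"
  unfolding alg_def[of X] by (blast intro: alg_add alg_mult mat_in_alg)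

lemma alg_eq_alg:
  assumes "\<not> scalar2 A" "X \<in> alg A" "\<not> scalar2 X"
  shows "alg X = alg A"
proof -
  have "X ** A = A ** X" using alg_commute[OF assms(2) alg_self] .
  then have "A \<in> alg X" using commuting_imp_alg[OF assms(3)] by metis
  then show ?thesis
    using alg_subset assms(2) by blast
qed

text \<open>A matrix that conjugates one generator of the field \<^term>\<open>alg A\<close> into the field induces a
  field automorphism over the base field: the identity or the conjugation.\<close>
lemma conjugate_in_alg:
  fixes A P X :: "'a::field^2^2"
  assumes "anisotropic A" "invertible P" "X \<in> alg A" "P ** X = Y ** P" "Y \<in> alg A" "\<not> scalar2 X"
  shows "(P \<in> alg A) \<or> (\<forall>Z\<in>alg A. P ** Z = adj2 Z ** P)"
proof -
  have inv: "trace X = trace Y" "det X = det Y"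
    using similar_invariants[OF assms(2,4)] .
  have AX: "alg X = alg A"
    using alg_eq_alg[OF anisotropic_not_scalar[OF assms(1)] assms(3,6)] .
  from alg_eq_or_adj2[OF assms(1,3,5) inv] show ?thesis
  proof
    assume "Y = X"
    then show ?thesis using assms(4) AX commuting_imp_alg[OF assms(6)] by auto
  next
    assume Y: "Y = adj2 X"
    have "P ** Z = adj2 Z ** P" if Z_in: "Z \<in> alg A" for Z
    proof -
      obtain x y where Z: "Z = mat x + mat y ** X"
        using Z_in[folded AX] by (auto simp: alg_def)
      have "P ** Z = mat x ** P + mat y ** (P ** X)"
        by (simp add: Z mat2_simps algebra_simps)
      also have "\<dots> = mat x ** P + mat y ** (adj2 X ** P)"
        by (simp add: assms(4) Y)
      also have "\<dots> = adj2 Z ** P"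
        by (simp add: Z adj2_def mat2_simps algebra_simps)
      finally show ?thesis .
    qed
    then show ?thesis by simp
  qed
qed

text \<open>Here \<^term>\<open>det\<close> is the norm to the base field and the quotient of \<^term>\<open>adj2 y\<close> by
  \<^term>\<open>y\<close> runs through the elements of norm one. The usual witness \<open>1 + adj2 e\<close> works unless
  it vanishes, that is, unless \<open>e = -1\<close>; then any nonzero element of trace zero will do, such as
  \<open>A - adj2 A\<close>, which vanishes only in characteristic two, where \<open>-1 = 1\<close>.\<close>
lemma hilbert_90:
  fixes e :: "'a::field^2^2"
  assumes "anisotropic A" "e \<in> alg A" "det e = 1"
  shows "\<exists>y\<in>alg A. y \<noteq> 0 \<and> adj2 y = e ** y"
proof (cases "mat 1 + adj2 e = 0")
  case False
  have "adj2 (mat 1 + adj2 e) = e + mat 1"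
    by (simp add: adj2_def mat2_simps algebra_simps)
  also have "\<dots> = e + e ** adj2 e"
    by (simp add: mult_adj2(1) assms(3))
  also have "\<dots> = e ** (mat 1 + adj2 e)"
    by (simp add: matrix_add_ldistrib)
  finally show ?thesis
    using False alg_add[OF mat_in_alg alg_adj2[OF assms(2)], of 1] by blast
next
  case True
  have e: "e = - mat 1"
  proof -
    have "adj2 e = - mat 1" using True by (simp add: eq_neg_iff_add_eq_0 add.commute)
    moreover have "e = adj2 (adj2 e)" by (simp add: adj2_def mat2_simps)
    ultimately have "e = adj2 (- mat 1)" by simp
    then show ?thesis by (simp add: adj2_def mat2_simps)
  qed
  show ?thesis
  proof (cases "(2::'a) = 0")
    case True
    then have "(1::'a) = - 1"
      by (simp add: eq_neg_iff_add_eq_0)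
    then have "adj2 (mat 1) = e ** mat 1"
      unfolding e by (simp add: adj2_def mat2_simps)
    moreover have "mat 1 \<noteq> (0 :: 'a^2^2)" by (simp add: mat2_simps)
    ultimately show ?thesis using mat_in_alg[of 1 A] by blast
  next
    case False
    have "A - adj2 A \<noteq> 0"
    proof
      assume "A - adj2 A = 0"
      then have z: "(A - adj2 A)$i$j = 0" for i j by simp
      have "2 * A$1$2 = 0 \<and> 2 * A$2$1 = 0 \<and> A$1$1 = A$2$2"
        using z[of 1 1] z[of 1 2] z[of 2 1] by (simp add: adj2_def mat2_simps)
      then have "scalar2 A" using False by (simp add: scalar2_iff)
      then show False using assms(1) anisotropic_not_scalar by blast
    qed
    moreover have "adj2 (A - adj2 A) = e ** (A - adj2 A)"
      unfolding e by (simp add: adj2_def mat2_simps algebra_simps)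
    ultimately show ?thesis using alg_diff[OF alg_self alg_adj2[OF alg_self], of A] by blast
  qed
qed

text \<open>For anisotropic matrices the first basis vector is cyclic. The witness is the change of basis
  that fixes it and sends its image under \<^term>\<open>A\<close> to its image under \<^term>\<open>B\<close>.\<close>
lemma similar_if_same_invariants:
  fixes A B :: "'a::field^2^2"
  assumes "anisotropic A" "anisotropic B" "trace A = trace B" "det A = det B"
  shows "\<exists>P. invertible P \<and> P ** A = B ** P"
proof -
  have n: "A$2$1 \<noteq> 0" "B$2$1 \<noteq> 0"
    using assms(1,2)[unfolded anisotropic_def, rule_format, of "A$1$1"]
      assms(1,2)[unfolded anisotropic_def, rule_format, of "B$1$1"]
    by (auto simp: mat2_simps)
  define P :: "'a^2^2" where "P = (\<chi> i j. if i = 1 then (if j = 1 then 1 else (B$1$1 - A$1$1) / A$2$1)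
     else (if j = 1 then 0 else B$2$1 / A$2$1))"
  have P: "P$1$1 = 1" "P$1$2 = (B$1$1 - A$1$1) / A$2$1" "P$2$1 = 0" "P$2$2 = B$2$1 / A$2$1"
    by (simp_all add: P_def)
  have t: "A$2$2 = B$1$1 + B$2$2 - A$1$1" and d: "A$1$1 * A$2$2 - A$1$2 * A$2$1 = B$1$1 * B$2$2 - B$1$2 * B$2$1"
    using assms(3,4) by (simp_all add: mat2_simps algebra_simps)
  have "det P \<noteq> 0" using n by (simp add: P mat2_simps)
  moreover have "P ** A = B ** P"
  proof -
    have "A$1$2 * A$2$1 + (B$1$1 - A$1$1) * A$2$2 = B$1$1 * (B$1$1 - A$1$1) + B$1$2 * B$2$1"
      using d unfolding t by (simp add: algebra_simps)
    then have "P$1$1 * A$1$2 + P$1$2 * A$2$2 = B$1$1 * P$1$2 + B$1$2 * P$2$2"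
      unfolding P using n by (simp add: field_simps)
    moreover have "P$1$1 * A$1$1 + P$1$2 * A$2$1 = B$1$1 * P$1$1 + B$1$2 * P$2$1"
      "P$2$1 * A$1$1 + P$2$2 * A$2$1 = B$2$1 * P$1$1 + B$2$2 * P$2$1"
      using n by (simp_all add: P)
    moreover have "P$2$1 * A$1$2 + P$2$2 * A$2$2 = B$2$1 * P$1$2 + B$2$2 * P$2$2"
      unfolding P t using n by (simp add: field_simps)
    ultimately show ?thesis by (simp add: vec_eq_iff forall_2 mult2_nth)
  qed
  ultimately show ?thesis using invertible_det_nz by blast
qed

section \<open>A quadratic field contains a root of every irreducible quadratic\<close>

lemma card_le_twice_card_image:
  assumes "finite X" "\<And>x. x \<in> X \<Longrightarrow> \<exists>y. \<forall>z\<in>X. f z = f x \<longrightarrow> z = x \<or> z = y"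
  shows "card X \<le> 2 * card (f ` X)"
proof -
  have fib: "card {z\<in>X. f z = v} \<le> 2" if v: "v \<in> f ` X" for v
  proof -
    obtain x where x: "x \<in> X" "v = f x" using v by blast
    obtain y where "\<forall>z\<in>X. f z = f x \<longrightarrow> z = x \<or> z = y"
      using assms(2)[OF x(1)] by blast
    then have "{z\<in>X. f z = v} \<subseteq> {x, y}" using x(2) by auto
    then have "card {z\<in>X. f z = v} \<le> card {x, y}" by (intro card_mono) auto
    also have "\<dots> \<le> 2" by (simp add: card_insert_if)
    finally show ?thesis .
  qed
  have "card X = card (\<Union>v\<in>f ` X. {z\<in>X. f z = v})"
    by (rule arg_cong[of _ _ card]) blast
  also have "\<dots> \<le> (\<Sum>v\<in>f ` X. card {z\<in>X. f z = v})"
    using assms(1) by (intro card_UN_le) simp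
  also have "\<dots> \<le> (\<Sum>v\<in>f ` X. 2)"
    using fib by (intro sum_mono) auto
  finally show ?thesis by (simp add: mult.commute)
qed

lemma alg_nonscalar_anisotropic:
  assumes "anisotropic A" "X \<in> alg A" "\<not> scalar2 X"
  shows "anisotropic X"
  unfolding anisotropic_def
proof
  fix c
  have "X - mat c \<noteq> 0" using assms(3) by (auto simp: scalar2_def)
  then show "det (X - mat c) \<noteq> 0"
    using alg_det_nonzero[OF assms(1) alg_diff[OF assms(2) mat_in_alg]] by blast
qed

lemma card_distinct_pairs:
  "card {(a, b). a \<noteq> (b :: 'a::finite)} = CARD('a)\<^sup>2 - CARD('a)"
proof -
  have "{(a, b). a \<noteq> (b :: 'a)} = UNIV - range (\<lambda>a. (a, a))" by auto
  also have "card \<dots> = card (UNIV :: ('a \<times> 'a) set) - card (range (\<lambda>a::'a. (a, a)))"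
    by (rule card_Diff_subset) auto
  also have "card (range (\<lambda>a::'a. (a, a))) = CARD('a)"
    by (rule card_image) (simp add: inj_on_def)
  finally show ?thesis by (simp add: power2_eq_square)
qed

text \<open>This is the uniqueness of the quadratic extension of a finite field, proved by counting. Let
  \<open>q\<close> be the number of scalars. The \<open>q\<^sup>2 - q\<close> nonscalar elements of \<^term>\<open>alg A\<close> have at least
  \<open>(q\<^sup>2 - q) / 2\<close> different characteristic polynomials, none of them with a root; the pairs
  \<open>(a, b)\<close> of scalars give at least \<open>(q\<^sup>2 - q) / 2 + q\<close> polynomials \<open>(T - a) (T - b)\<close>. Together
  these are all \<open>q\<^sup>2\<close> monic quadratic polynomials, so an irreducible one is of the first kind.\<close>
lemma alg_realises_invariants:
  fixes A B :: "'a::{field,finite}^2^2"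
  assumes A: "anisotropic A" and B: "anisotropic B"
  shows "\<exists>X\<in>alg A. trace X = trace B \<and> det X = det B"
proof -
  \<comment> \<open>Using \<open>y - x\<close> as coefficient of \<^term>\<open>A\<close> makes the nonscalar elements correspond to the
    pairs of distinct scalars, the same index set as for the products of linear factors.\<close>
  define e where "e = (\<lambda>(x, y). mat x + mat (y - x) ** A)"
  define f where "f = (\<lambda>p. (trace (e p), det (e p)))"
  define g where "g = (\<lambda>(a, b). (a + b, a * b :: 'a))"
  define N where "N = {(a, b). a \<noteq> (b :: 'a)}"
  define D where "D = range (\<lambda>a::'a. (a, a))"
  have e_alg: "e p \<in> alg A" for p by (auto simp: e_def alg_def split: prod.split)
  have ns: "\<not> scalar2 A" using A anisotropic_not_scalar by blast
  have e_inj: "p = p'" if eq: "e p = e p'" for p p'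
  proof -
    obtain x y x' y' where p: "p = (x, y)" "p' = (x', y')" by (cases p, cases p')
    define u where "u = (y - x) - (y' - x')"
    have "(e p)$i$j = (e p')$i$j" for i j using eq by simp
    from this[of 1 1] this[of 1 2] this[of 2 1] this[of 2 2]
    have 1: "x + (y - x) * A$1$1 = x' + (y' - x') * A$1$1"
      and 2: "x + (y - x) * A$2$2 = x' + (y' - x') * A$2$2"
      and "u * A$1$2 = 0" "u * A$2$1 = 0"
      by (simp_all add: p e_def u_def mult2_nth mat2_nth left_diff_distrib)
    moreover have "u * (A$1$1 - A$2$2) = 0"
    proof -
      have "u * (A$1$1 - A$2$2) = (x + (y - x) * A$1$1) - (x + (y - x) * A$2$2)
          - ((x' + (y' - x') * A$1$1) - (x' + (y' - x') * A$2$2))"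
        by (simp add: u_def algebra_simps)
      then show ?thesis unfolding 1 2 by simp
    qed
    ultimately have "u = 0" using ns unfolding scalar2_iff by auto
    then have d: "y - x = y' - x'" by (simp add: u_def)
    then have "x = x'" using 1 by simp
    then show ?thesis using d p by simp
  qed
  then have e_inj': "inj e" by (rule injI)
  have e_ns: "\<not> scalar2 (e p)" if "p \<in> N" for p
    using that ns unfolding e_def scalar2_iff N_def by (cases p) (auto simp: mat2_simps)
  have noroot_f: "c\<^sup>2 - s * c + d \<noteq> 0" if "(s, d) \<in> f ` N" for s d c
  proof -
    obtain p where p: "p \<in> N" "s = trace (e p)" "d = det (e p)" using \<open>(s, d) \<in> f ` N\<close> by (auto simp: f_def)
    have "det (e p - mat c) \<noteq> 0"
      using alg_nonscalar_anisotropic[OF A e_alg e_ns[OF p(1)]] by (simp add: anisotropic_def)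
    then show ?thesis unfolding p(2,3) det_minus_mat .
  qed
  have root_g: "\<exists>c. c\<^sup>2 - s * c + d = 0" if "(s, d) \<in> range g" for s d
  proof -
    obtain a b where "s = a + b" "d = a * b" using \<open>(s, d) \<in> range g\<close> by (auto simp: g_def)
    then show ?thesis by (intro exI[of _ a]) (simp add: power2_eq_square algebra_simps)
  qed
  have g_fib: "z = p \<or> z = prod.swap p" if eq: "g z = g p" for z p
  proof -
    obtain a b a' b' where zp: "z = (a', b')" "p = (a, b)" by (cases z, cases p)
    have s: "b' = a + b - a'" and p: "a' * b' = a * b"
      using eq by (auto simp: zp g_def algebra_simps)
    have "(a' - a) * (a' - b) = 0" using p unfolding s by (simp add: algebra_simps)
    then show ?thesis using s by (auto simp: zp)
  qed
  have cN: "card N = CARD('a)\<^sup>2 - CARD('a)"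
    unfolding N_def by (rule card_distinct_pairs)
  have c1: "card N \<le> 2 * card (f ` N)"
  proof (rule card_le_twice_card_image)
    fix p assume "p \<in> N"
    show "\<exists>y. \<forall>z\<in>N. f z = f p \<longrightarrow> z = p \<or> z = y"
    proof (intro exI ballI impI)
      fix z assume "z \<in> N" "f z = f p"
      then have "e z = e p \<or> e z = adj2 (e p)"
        using alg_eq_or_adj2[OF A e_alg[of p] e_alg[of z]] by (simp add: f_def)
      then show "z = p \<or> z = inv_into UNIV e (adj2 (e p))"
      proof
        assume "e z = e p"
        then show ?thesis using e_inj by blast
      next
        assume "e z = adj2 (e p)"
        then have "inv_into UNIV e (adj2 (e p)) = z" using inv_f_f[OF e_inj'] by metis
        then show ?thesis by blast
      qed
    qed
  qed simp
  have c2: "card N \<le> 2 * card (g ` N)"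
  proof (rule card_le_twice_card_image)
    fix p assume "p \<in> N"
    show "\<exists>y. \<forall>z\<in>N. g z = g p \<longrightarrow> z = p \<or> z = y"
    proof (intro exI ballI impI)
      fix z assume "g z = g p"
      then show "z = p \<or> z = prod.swap p" by (rule g_fib)
    qed
  qed simp
  have c3: "card (g ` D) = CARD('a)"
  proof -
    have "inj (\<lambda>a. g (a, a))"
      by (rule injI) (use g_fib in force)
    then have "card (range (\<lambda>a. g (a, a))) = CARD('a)" by (rule card_image)
    then show ?thesis by (simp add: D_def image_image)
  qed
  have d1: "g ` N \<inter> g ` D = {}"
  proof -
    have "g p \<noteq> g (a, a)" if "p \<in> N" for p a
    proof
      assume "g p = g (a, a)"
      then have "p = (a, a)" using g_fib[of p "(a, a)"] by simp
      then show False using that by (simp add: N_def)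
    qed
    then show ?thesis unfolding D_def by blast
  qed
  have d2: "f ` N \<inter> (g ` N \<union> g ` D) = {}"
  proof -
    have "(s, d) \<notin> range g" if "(s, d) \<in> f ` N" for s d
      using noroot_f[OF that] root_g by blast
    then have "f ` N \<inter> range g = {}" by (metis disjoint_iff surj_pair)
    then show ?thesis by blast
  qed
  have "card (f ` N \<union> (g ` N \<union> g ` D)) = card (f ` N) + (card (g ` N) + CARD('a))"
    using d1 d2 c3 by (simp add: card_Un_disjoint)
  moreover have "CARD('a) \<le> CARD('a)\<^sup>2" by (simp add: power2_eq_square)
  ultimately have "CARD('a)\<^sup>2 \<le> card (f ` N \<union> (g ` N \<union> g ` D))"
    using c1 c2 cN by linarith
  then have "f ` N \<union> (g ` N \<union> g ` D) = UNIV"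
    by (intro card_seteq) (simp_all add: power2_eq_square)
  moreover have "(trace B, det B) \<notin> range g"
    using root_g B det_minus_mat[of B] by (fastforce simp: anisotropic_def)
  ultimately have "(trace B, det B) \<in> f ` N" by blast
  then show ?thesis using e_alg by (auto simp: f_def)
qed

section \<open>The general linear group\<close>

interpretation GL2: group "GL2 :: ('a::field^2^2) monoid"
  by (rule group_GL2)

lemma GL2_simps:
  "carrier GL2 = {A. invertible A}" "A \<otimes>\<^bsub>GL2\<^esub> B = A ** B" "\<one>\<^bsub>GL2\<^esub> = mat 1"
  by (simp_all add: GL2_def)

lemma subgroup_GL2D:
  assumes "subgroup K (GL2 :: ('a::field^2^2) monoid)"
  shows "A \<in> K \<Longrightarrow> invertible A" "mat 1 \<in> K" "A \<in> K \<Longrightarrow> B \<in> K \<Longrightarrow> A ** B \<in> K"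
    "A \<in> K \<Longrightarrow> \<exists>B\<in>K. A ** B = mat 1 \<and> B ** A = mat 1"
proof -
  interpret K: subgroup K GL2 by fact
  show "A \<in> K \<Longrightarrow> invertible A" "mat 1 \<in> K" "A \<in> K \<Longrightarrow> B \<in> K \<Longrightarrow> A ** B \<in> K"
    using K.subset K.one_closed K.m_closed by (auto simp: GL2_simps)
  show "\<exists>B\<in>K. A ** B = mat 1 \<and> B ** A = mat 1" if "A \<in> K"
    using K.m_inv_closed[OF that] GL2.r_inv[OF K.mem_carrier[OF that]]
      GL2.l_inv[OF K.mem_carrier[OF that]]
    by (auto simp: GL2_simps)
qed

lemma invertible_obtain_inverse:
  assumes "invertible (P :: 'a::field^2^2)"
  obtains Q where "P ** Q = mat 1" "Q ** P = mat 1" "invertible Q"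
  using assms by (auto simp: invertible_def)

lemma invertible_mult_cancel:
  assumes "invertible (P :: 'a::field^2^2)"
  shows "P ** A = P ** B \<Longrightarrow> A = B" "A ** P = B ** P \<Longrightarrow> A = B"
proof -
  obtain Q where Q: "P ** Q = mat 1" "Q ** P = mat 1"
    using invertible_obtain_inverse[OF assms] .
  show "A = B" if "P ** A = P ** B"
    using arg_cong[OF that, of "\<lambda>X. Q ** X"] by (simp add: Q matrix_mul_assoc)
  show "A = B" if "A ** P = B ** P"
    using arg_cong[OF that, of "\<lambda>X. X ** Q"] by (simp add: Q flip: matrix_mul_assoc)
qed

lemma mat_commute: "mat c ** A = A ** mat c" for A :: "'a::field^2^2"
  by (simp add: mat2_simps algebra_simps)

section \<open>Normal abelian subgroups of primitive groups\<close>

definition eigenspace :: "'a::field^2^2 \<Rightarrow> 'a \<Rightarrow> ('a^2) set" where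
  "eigenspace B c = {v. B *v v = c *s v}"

lemma matvec2_nth: "(B *v v)$i = B$i$1 * v$1 + B$i$2 * v$2" for B :: "'a::semiring_1^2^2"
  by (simp add: matrix_vector_mult_def sum_2)

text \<open>The matrix \<open>B - mat c\<close> is singular and nonzero, so its kernel is spanned by a vector
  orthogonal to any of its nonzero rows.\<close>
lemma one_dim_subspace_eigenspace:
  assumes "\<not> scalar2 B" "det (B - mat c) = 0"
  shows "one_dim_subspace (eigenspace B c)"
proof -
  define M where "M = B - mat c"
  have dM: "M$1$1 * M$2$2 = M$1$2 * M$2$1" using assms(2) by (simp add: M_def det_2)
  have E: "eigenspace B c = {v. \<forall>i. M$i$1 * v$1 + M$i$2 * v$2 = 0}"
    by (auto simp: eigenspace_def M_def vec_eq_iff forall_2 matvec2_nth mat2_nth algebra_simps)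
  have "M \<noteq> 0" using assms(1) unfolding M_def scalar2_def by auto
  then obtain i where i: "M$i$1 \<noteq> 0 \<or> M$i$2 \<noteq> 0"
    by (auto simp: vec_eq_iff forall_2)
  define w :: "'a^2" where "w = (\<chi> j. if j = 1 then - (M$i$2) else M$i$1)"
  have w: "w$1 = - (M$i$2)" "w$2 = M$i$1" by (simp_all add: w_def)
  have w0: "w \<noteq> 0" using i w by (auto simp: vec_eq_iff forall_2)
  have "eigenspace B c = vec.span {w}"
  proof (intro Set.set_eqI iffI)
    fix v assume "v \<in> eigenspace B c"
    then have v: "M$i$1 * v$1 + M$i$2 * v$2 = 0" unfolding E by blast
    have "\<exists>k. v = k *s w"
    proof (cases "M$i$1 = 0")
      case False
      then have "v = (v$2 / M$i$1) *s w"
        using v by (simp add: vec_eq_iff forall_2 w field_simps eq_neg_iff_add_eq_0)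
      then show ?thesis by blast
    next
      case True
      then have "v = (- (v$1) / M$i$2) *s w"
        using v i by (simp add: vec_eq_iff forall_2 w)
      then show ?thesis by blast
    qed
    then show "v \<in> vec.span {w}" by (auto simp: vec.span_singleton)
  next
    fix v assume "v \<in> vec.span {w}"
    then obtain k where v: "v = k *s w" by (auto simp: vec.span_singleton)
    have "M$j$1 * w$1 + M$j$2 * w$2 = 0" for j
      using dM exhaust_2[of i] exhaust_2[of j] by (auto simp: w algebra_simps)
    then have "k * (M$j$1 * w$1 + M$j$2 * w$2) = 0" for j by simp
    then show "v \<in> eigenspace B c" unfolding E v by (simp add: algebra_simps)
  qed
  moreover have "vec.independent {w}" using w0 by simp
  ultimately show ?thesis
    using vec.dim_span_eq_card_independent[of "{w}"] by (simp add: one_dim_subspace_def vec.subspace_span)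
qed

lemma eigenspace_image:
  assumes "invertible k" "k ** b = b' ** k"
  shows "(*v) k ` eigenspace b c = eigenspace b' c"
proof (intro Set.set_eqI iffI)
  fix w assume "w \<in> (*v) k ` eigenspace b c"
  then obtain v where v: "b *v v = c *s v" "w = k *v v" by (auto simp: eigenspace_def)
  have "b' *v w = (k ** b) *v v" by (simp add: v(2) assms(2) matrix_vector_mul_assoc)
  also have "\<dots> = c *s w" by (simp add: v vec.scale flip: matrix_vector_mul_assoc)
  finally show "w \<in> eigenspace b' c" by (simp add: eigenspace_def)
next
  fix w assume "w \<in> eigenspace b' c"
  then have w: "b' *v w = c *s w" by (simp add: eigenspace_def)
  obtain l where l: "k ** l = mat 1" "l ** k = mat 1"
    using assms(1) by (auto simp: invertible_def)
  have "b ** l = l ** (k ** b) ** l" by (simp add: l matrix_mul_assoc)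
  also have "\<dots> = l ** b' ** (k ** l)" by (simp add: assms(2) matrix_mul_assoc)
  finally have bl: "b ** l = l ** b'" by (simp add: l)
  have "b *v (l *v w) = (l ** b') *v w" by (simp add: matrix_vector_mul_assoc bl)
  also have "\<dots> = c *s (l *v w)" by (simp add: w vec.scale flip: matrix_vector_mul_assoc)
  finally have "b *v (l *v w) = c *s (l *v w)" .
  moreover have "w = k *v (l *v w)" by (simp add: matrix_vector_mul_assoc l)
  ultimately show "w \<in> (*v) k ` eigenspace b c" by (auto simp: eigenspace_def)
qed

lemma eigenspace_affine:
  assumes "y \<noteq> 0"
  shows "eigenspace (mat x + mat y ** b) c = eigenspace b ((c - x) / y)"
proof -
  have "(mat x + mat y ** b) *v v = c *s v \<longleftrightarrow> b *v v = ((c - x) / y) *s v" for v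
  proof -
    have "((mat x + mat y ** b) *v v)$i = x * v$i + y * (b *v v)$i" for i
      using exhaust_2[of i] by (auto simp: matvec2_nth mult2_nth mat2_nth algebra_simps)
    moreover have "x * v$i + y * u = c * v$i \<longleftrightarrow> u = ((c - x) / y) * v$i" for i u
      using assms by (auto simp: field_simps)
    ultimately show ?thesis by (simp add: vec_eq_iff)
  qed
  then show ?thesis by (simp add: eigenspace_def)
qed

lemma eigenspaces_disjoint:
  assumes "v \<in> eigenspace b c" "v \<in> eigenspace b d" "c \<noteq> d"
  shows "v = 0"
  using assms by (auto simp: eigenspace_def)

lemma one_dim_subspace_nonzero:
  "one_dim_subspace W \<Longrightarrow> \<exists>v\<in>W. v \<noteq> 0"
  unfolding one_dim_subspace_def using vec.dim_eq_0[of W] by auto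

lemma eigenvalue_det:
  assumes "v \<in> eigenspace b c" "v \<noteq> 0"
  shows "det (b - mat c) = 0"
proof (rule ccontr)
  assume "det (b - mat c) \<noteq> 0"
  then obtain Q where Q: "Q ** (b - mat c) = mat 1"
    using invertible_obtain_inverse invertible_det_nz by metis
  have "(b - mat c) *v v = 0"
    using assms(1) by (simp add: eigenspace_def vec_eq_iff forall_2 matvec2_nth mat2_nth algebra_simps)
  then have "(Q ** (b - mat c)) *v v = 0"
    by (simp flip: matrix_vector_mul_assoc)
  then show False using assms(2) by (simp add: Q)
qed

text \<open>By the Cayley-Hamilton theorem \<open>b - d\<close> maps into the eigenspace of \<open>c\<close> and vice versa, and
  the two maps differ by the nonzero scalar \<open>c - d\<close>.\<close>
lemma eigenspaces_direct_sum:
  assumes "det (b - mat c) = 0" "trace b = c + d" "c \<noteq> d"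
  shows "internal_direct_sum (eigenspace b c) (eigenspace b d)"
  unfolding internal_direct_sum_def
proof
  show "eigenspace b c \<inter> eigenspace b d = {0}"
    using eigenspaces_disjoint[OF _ _ assms(3)] by (auto simp: eigenspace_def)
  have dt: "det b = c * d"
    using assms(1) unfolding det_minus_mat assms(2) by (simp add: algebra_simps power2_eq_square)
  have bb: "b *v (b *v v) = (c + d) *s (b *v v) - (c * d) *s v" for v
  proof -
    have "b *v (b *v v) = (mat (c + d) ** b - mat (c * d)) *v v"
      unfolding matrix_vector_mul_assoc cayley_hamilton2[of b] assms(2) dt ..
    also have "\<dots> = (c + d) *s (b *v v) - (c * d) *s v"
      by (simp add: vec_eq_iff forall_2 matvec2_nth mult2_nth mat2_nth algebra_simps)
    finally show ?thesis .
  qed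
  have scale: "k *s u \<in> eigenspace b e" if "u \<in> eigenspace b e" for u k e
    using that by (simp add: eigenspace_def vec.scale mult.commute)
  have "\<exists>x y. v = x + y \<and> x \<in> eigenspace b c \<and> y \<in> eigenspace b d" for v
  proof -
    define x where "x = (1 / (c - d)) *s (b *v v - d *s v)"
    define y where "y = (1 / (d - c)) *s (b *v v - c *s v)"
    have "b *v (b *v v - d *s v) = c *s (b *v v - d *s v)"
      unfolding vec.diff vec.scale bb by (simp add: vec_eq_iff algebra_simps)
    then have "x \<in> eigenspace b c"
      unfolding x_def by (intro scale) (simp add: eigenspace_def)
    moreover have "b *v (b *v v - c *s v) = d *s (b *v v - c *s v)"
      unfolding vec.diff vec.scale bb by (simp add: vec_eq_iff algebra_simps)
    then have "y \<in> eigenspace b d"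
      unfolding y_def by (intro scale) (simp add: eigenspace_def)
    moreover have "v = x + y"
    proof -
      have split: "v$i = (w - d * v$i) / (c - d) + (w - c * v$i) / (d - c)" for i w
      proof -
        have "(w - c * v$i) / (d - c) = - ((w - c * v$i) / (c - d))"
          using minus_divide_right[of "w - c * v$i" "c - d"] by simp
        then have "(w - d * v$i) / (c - d) + (w - c * v$i) / (d - c)
            = ((w - d * v$i) - (w - c * v$i)) / (c - d)"
          by (simp add: diff_divide_distrib)
        also have "(w - d * v$i) - (w - c * v$i) = v$i * (c - d)" by (simp add: algebra_simps)
        also have "v$i * (c - d) / (c - d) = v$i" using assms(3) by simp
        finally show ?thesis by simp
      qed
      have "(x + y)$i = ((b *v v)$i - d * v$i) / (c - d) + ((b *v v)$i - c * v$i) / (d - c)" for i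
        by (simp add: x_def y_def diff_divide_distrib)
      then show ?thesis unfolding vec_eq_iff using split by metis
    qed
    ultimately show ?thesis by blast
  qed
  then show "{x + y |x y. x \<in> eigenspace b c \<and> y \<in> eigenspace b d} = UNIV" by auto
qed

text \<open>This is the case of Clifford's theorem that is needed. Conjugates of \<open>b\<close> in \<open>B\<close> commute with
  \<open>b\<close> and are therefore affine expressions \<open>x + y b\<close>, so \<open>K\<close> permutes the eigenspaces of \<open>b\<close>.
  If \<open>b\<close> has an eigenvalue, these are one or two lines. A single line is invariant, and two lines
  form a system of imprimitivity.\<close>
lemma normal_abelian_subgroup_anisotropic:
  assumes prim: "primitive_subgroup K"
    and BK: "B \<subseteq> K"
    and comm: "\<And>x y. x \<in> B \<Longrightarrow> y \<in> B \<Longrightarrow> x ** y = y ** x"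
    and normal: "\<And>k x. k \<in> K \<Longrightarrow> x \<in> B \<Longrightarrow> \<exists>y\<in>B. k ** x = y ** k"
    and b: "b \<in> B" "\<not> scalar2 b"
  shows "anisotropic b"
proof (rule ccontr)
  assume "\<not> anisotropic b"
  then obtain c where c: "det (b - mat c) = 0" by (auto simp: anisotropic_def)
  define d where "d = trace b - c"
  have tr: "trace b = c + d" by (simp add: d_def)
  have dt: "det b = c * d"
    using c unfolding det_minus_mat tr by (simp add: algebra_simps power2_eq_square)
  have roots: "det (b - mat e) = 0 \<longleftrightarrow> e = c \<or> e = d" for e
  proof -
    have "det (b - mat e) = (e - c) * (e - d)"
      unfolding det_minus_mat tr dt by (simp add: algebra_simps power2_eq_square)
    then show ?thesis by simp
  qed
  define V where "V = eigenspace b"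
  have irr: "irreducible_subgroup K" and K: "subgroup K GL2"
    using prim by (auto simp: primitive_subgroup_def irreducible_subgroup_def)
  have line: "one_dim_subspace (V c)" "one_dim_subspace (V d)"
    unfolding V_def using one_dim_subspace_eigenspace[OF b(2)] roots by blast+
  have act: "\<exists>x y. y \<noteq> 0 \<and> (\<forall>e. (*v) k ` V e = V ((e - x) / y))" if k: "k \<in> K" for k
  proof -
    obtain b' where b': "b' \<in> B" "k ** b = b' ** k" using normal[OF k b(1)] by blast
    obtain x y where xy: "b' = mat x + mat y ** b"
      using commuting_imp_alg[OF b(2) comm[OF b'(1) b(1)]] by (auto simp: alg_def)
    have inv: "invertible k" using subgroup_GL2D(1)[OF K k] .
    have "y \<noteq> 0"
    proof
      assume "y = 0"
      then have "b' = mat x" unfolding xy by (simp add: mat2_simps)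
      then have "k ** b = k ** mat x" using b'(2) mat_commute by metis
      then have "b = mat x" using invertible_mult_cancel(1)[OF inv] by blast
      then show False using b(2) by (auto simp: scalar2_def)
    qed
    then show ?thesis
      using eigenspace_image[OF inv b'(2)] eigenspace_affine unfolding V_def xy by metis
  qed
  have act_root: "det (b - mat e') = 0"
    if k: "k \<in> K" and e: "det (b - mat e) = 0" and im: "(*v) k ` V e = V e'" for k e e'
  proof -
    obtain v where v: "v \<in> V e" "v \<noteq> 0"
      using one_dim_subspace_nonzero one_dim_subspace_eigenspace[OF b(2) e] by (auto simp: V_def)
    obtain Q where Q: "Q ** k = mat 1"
      using invertible_obtain_inverse[OF subgroup_GL2D(1)[OF K k]] .
    have "Q *v (k *v v) = v" by (simp add: matrix_vector_mul_assoc Q)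
    then have "k *v v \<noteq> 0" using v(2) by auto
    moreover have "k *v v \<in> eigenspace b e'" using im v(1) by (auto simp: V_def)
    ultimately show ?thesis by (rule eigenvalue_det[rotated])
  qed
  have perm: "((*v) k ` V c = V c \<and> (*v) k ` V d = V d) \<or> ((*v) k ` V c = V d \<and> (*v) k ` V d = V c)"
    if k: "k \<in> K" for k
  proof -
    obtain x y where y: "y \<noteq> 0" and im: "\<And>e. (*v) k ` V e = V ((e - x) / y)"
      using act[OF k] by blast
    have "(c - x) / y = c \<or> (c - x) / y = d" "(d - x) / y = c \<or> (d - x) / y = d"
      using act_root[OF k _ im] roots by blast+
    moreover have "(c - x) / y \<noteq> (d - x) / y" if "c \<noteq> d" using y that by simp
    ultimately show ?thesis unfolding im by metis
  qed
  show False
  proof (cases "c = d")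
    case True
    then have "\<forall>k\<in>K. (*v) k ` V c \<subseteq> V c" using perm by simp
    then show False using irr line(1) unfolding irreducible_subgroup_def by blast
  next
    case False
    have "\<forall>k\<in>K. (`) ((*v) k) ` {V c, V d} = {V c, V d}"
    proof
      fix k assume "k \<in> K"
      from perm[OF this] show "(`) ((*v) k) ` {V c, V d} = {V c, V d}"
        by (elim disjE conjE) (simp_all add: insert_commute)
    qed
    moreover have "internal_direct_sum (V c) (V d)"
      unfolding V_def using eigenspaces_direct_sum[OF c tr False] .
    ultimately have "imprimitive_subgroup K"
      unfolding imprimitive_subgroup_def using irr line by blast
    then show False using prim by (simp add: primitive_subgroup_def)
  qed
qed

lemma irreducible_not_all_scalar:
  assumes "irreducible_subgroup K"
  shows "\<exists>k\<in>K. \<not> scalar2 k"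
proof (rule ccontr)
  assume "\<not> (\<exists>k\<in>K. \<not> scalar2 k)"
  then have sc: "\<exists>c. k = mat c" if "k \<in> K" for k using that by (auto simp: scalar2_def)
  define W where "W = (vec.span {axis 1 1} :: ('a^2) set)"
  have "axis 1 1 \<noteq> (0 :: 'a^2)" by (simp add: axis_eq_0_iff)
  then have "vec.independent {axis 1 1 :: 'a^2}" by simp
  then have "one_dim_subspace W"
    using vec.dim_span_eq_card_independent[of "{axis 1 1 :: 'a^2}"]
    by (simp add: one_dim_subspace_def W_def vec.subspace_span)
  moreover have "(*v) k ` W \<subseteq> W" if k: "k \<in> K" for k
  proof -
    obtain c where "k = mat c" using sc[OF k] by blast
    then have "k *v w = c *s w" for w :: "'a^2"
      by (simp add: vec_eq_iff forall_2 matvec2_nth mat2_nth)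
    then show ?thesis unfolding W_def by (auto intro: vec.span_scale)
  qed
  ultimately show False using assms unfolding irreducible_subgroup_def by blast
qed

section \<open>Conjugation of subgroups\<close>

lemma conjugation_mult:
  fixes P Q :: "'a::field^2^2"
  assumes "Q ** P = mat 1"
  shows "P ** (x ** y) ** Q = P ** x ** Q ** (P ** y ** Q)"
proof -
  have "P ** x ** Q ** (P ** y ** Q) = P ** x ** (Q ** P) ** y ** Q"
    by (simp add: matrix_mul_assoc)
  then show ?thesis by (simp add: assms matrix_mul_assoc)
qed

lemma conj_subgroup_eq_image:
  assumes "P ** Q = mat 1" "Q ** P = mat 1"
  shows "conj_subgroup P K = (\<lambda>X. P ** X ** Q) ` K"
proof -
  have "invertible P" "invertible Q" using assms by (auto simp: invertible_def)
  then have "inv\<^bsub>GL2\<^esub> P = Q"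
    using GL2.inv_equality[of Q P] assms by (simp add: GL2_simps)
  then show ?thesis
    by (auto simp: conj_subgroup_def l_coset_def r_coset_def GL2_simps)
qed

lemma conj_subgroup_conj_subgroup:
  assumes "invertible P" "invertible R"
  shows "conj_subgroup P (conj_subgroup R K) = conj_subgroup (P ** R) K"
proof -
  obtain Q where Q: "P ** Q = mat 1" "Q ** P = mat 1" using invertible_obtain_inverse[OF assms(1)] .
  obtain S where S: "R ** S = mat 1" "S ** R = mat 1" using invertible_obtain_inverse[OF assms(2)] .
  have "(P ** R) ** (S ** Q) = P ** (R ** S) ** Q" "(S ** Q) ** (P ** R) = S ** (Q ** P) ** R"
    by (simp_all add: matrix_mul_assoc)
  then have PR: "(P ** R) ** (S ** Q) = mat 1" "(S ** Q) ** (P ** R) = mat 1"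
    by (simp_all add: Q S)
  show ?thesis
    unfolding conj_subgroup_eq_image[OF Q] conj_subgroup_eq_image[OF S] conj_subgroup_eq_image[OF PR]
    by (simp add: image_image matrix_mul_assoc)
qed

lemma conj_subgroup_one: "conj_subgroup (mat 1) K = K"
  using conj_subgroup_eq_image[of "mat 1" "mat 1" K] by simp

lemma conj_subgroup_eq_imp:
  assumes "invertible P" "invertible R" "conj_subgroup P K = conj_subgroup R H"
  shows "\<exists>g. invertible g \<and> K = conj_subgroup g H"
proof -
  obtain Q where Q: "Q ** P = mat 1" "invertible Q" using invertible_obtain_inverse[OF assms(1)] .
  have "K = conj_subgroup (Q ** P) K" by (simp add: Q conj_subgroup_one)
  also have "\<dots> = conj_subgroup Q (conj_subgroup R H)"
    using conj_subgroup_conj_subgroup[OF Q(2) assms(1)] assms(3) by metis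
  also have "\<dots> = conj_subgroup (Q ** R) H"
    by (rule conj_subgroup_conj_subgroup[OF Q(2) assms(2)])
  finally show ?thesis using invertible_mult[OF Q(2) assms(2)] by blast
qed

lemma orbit_conj_subgroup:
  assumes "invertible g"
  shows "orbit GL2 conj_subgroup (conj_subgroup g H) \<subseteq> orbit GL2 conj_subgroup H"
proof
  fix L assume "L \<in> orbit GL2 conj_subgroup (conj_subgroup g H)"
  then obtain h where h: "invertible h" "L = conj_subgroup h (conj_subgroup g H)"
    by (auto simp: orbit_def GL2_simps)
  then have "L = conj_subgroup (h ** g) H" by (simp add: conj_subgroup_conj_subgroup assms)
  then show "L \<in> orbit GL2 conj_subgroup H"
    using invertible_mult[OF h(1) assms] by (auto simp: orbit_def GL2_simps)
qed

lemma orbits_singleton: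
  assumes "H \<in> E" "\<And>K. K \<in> E \<Longrightarrow> \<exists>g. invertible g \<and> K = conj_subgroup g H"
  shows "orbits GL2 E conj_subgroup = {orbit GL2 conj_subgroup H}"
proof -
  have "orbit GL2 conj_subgroup K = orbit GL2 conj_subgroup H" if K: "K \<in> E" for K
  proof -
    obtain g where g: "invertible g" "K = conj_subgroup g H" using assms(2)[OF K] by blast
    obtain g' where g': "g' ** g = mat 1" "invertible g'"
      using invertible_obtain_inverse[OF g(1)] .
    have "H = conj_subgroup g' K"
      unfolding g(2) conj_subgroup_conj_subgroup[OF g'(2) g(1)] g'(1) conj_subgroup_one ..
    then show ?thesis
      using orbit_conj_subgroup[OF g(1), of H] orbit_conj_subgroup[OF g'(2), of K] g(2) by simp
  qed
  then show ?thesis unfolding orbits_def using assms(1) by blast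
qed

lemma subgroup_hom_image:
  fixes \<psi> :: "'a::field^2^2 \<Rightarrow> 'a^2^2"
  assumes "subgroup A GL2"
    and "\<And>x y. x \<in> A \<Longrightarrow> y \<in> A \<Longrightarrow> \<psi> (x ** y) = \<psi> x ** \<psi> y"
    and "\<And>x. x \<in> A \<Longrightarrow> invertible (\<psi> x)"
  shows "subgroup (\<psi> ` A) GL2"
proof -
  interpret A: group "GL2\<lparr>carrier := A\<rparr>" using assms(1) by (rule GL2.subgroup_imp_group)
  interpret group_hom "GL2\<lparr>carrier := A\<rparr>" GL2 \<psi>
    by unfold_locales (use assms(2,3) in \<open>auto simp: hom_def GL2_simps\<close>)
  show ?thesis using img_is_subgroup by simp
qed

section \<open>Cyclic groups and Singer cycles\<close>

text \<open>A cyclic group has at most \<open>m\<close> elements \<open>x\<close> with \<open>x ^ m = 1\<close>, for \<open>m\<close> dividing its order,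
  and a subgroup of order \<open>m\<close> consists of such elements.\<close>
lemma subgroup_card_eq_imp_eq:
  assumes gen: "S = {g [^]\<^bsub>GL2\<^esub> k | k::nat. True}" and S: "subgroup S (GL2 :: ('a::{field,finite}^2^2) monoid)"
    and X: "subgroup X GL2" "X \<subseteq> S" and Y: "subgroup Y GL2" "Y \<subseteq> S"
    and card: "card X = card Y"
  shows "X = Y"
proof -
  define m where "m = card X"
  define R where "R = {x \<in> S. x [^]\<^bsub>GL2\<^esub> m = \<one>\<^bsub>GL2\<^esub>}"
  interpret S: group "GL2\<lparr>carrier := S\<rparr>" using S by (rule GL2.subgroup_imp_group)
  have g: "g \<in> carrier GL2"
  proof -
    have "g [^]\<^bsub>GL2\<^esub> (1::nat) = g" by (simp add: nat_pow_def GL2_simps)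
    moreover have "g [^]\<^bsub>GL2\<^esub> (1::nat) \<in> S" unfolding gen by blast
    ultimately show ?thesis using subgroup.mem_carrier[OF S] by simp
  qed
  have m0: "m > 0"
    using subgroup.one_closed[OF X(1)] unfolding m_def by (auto simp: card_gt_0_iff)
  have gen': "S = generate GL2 {g}"
    unfolding gen using GL2.generate_pow_on_finite_carrier[OF _ g] by simp
  have ord: "GL2.ord g = card S"
    using GL2.generate_pow_card[OF g] gen' by simp
  have "card (rcosets\<^bsub>GL2\<lparr>carrier := S\<rparr>\<^esub> X) * m = card S"
    using S.lagrange[OF GL2.subgroup_incl[OF X(1) S X(2)]] by (simp add: order_def m_def)
  then have "m dvd card S" using dvd_triv_right by metis
  then obtain l where l: "card S = m * l" by blast
  have gl: "g [^]\<^bsub>GL2\<^esub> (l * m) = \<one>\<^bsub>GL2\<^esub>"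
    using GL2.pow_ord_eq_1[OF g] by (simp add: ord l mult.commute)
  have "R \<subseteq> (\<lambda>j. g [^]\<^bsub>GL2\<^esub> (l * j)) ` {..<m}"
  proof
    fix x assume "x \<in> R"
    then obtain k :: nat where k: "x = g [^]\<^bsub>GL2\<^esub> k" "x [^]\<^bsub>GL2\<^esub> m = \<one>\<^bsub>GL2\<^esub>"
      unfolding R_def gen by blast
    have "g [^]\<^bsub>GL2\<^esub> (k * m) = \<one>\<^bsub>GL2\<^esub>"
      using k by (simp add: GL2.nat_pow_pow g)
    then have "m * l dvd m * k" by (simp add: GL2.pow_eq_id g ord l mult.commute)
    then have "l dvd k" using m0 by simp
    then obtain j where j: "k = l * j" by blast
    have "l * j = l * m * (j div m) + l * (j mod m)"
      by (metis distrib_left mult.assoc mult_div_mod_eq)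
    then have "x = (g [^]\<^bsub>GL2\<^esub> (l * m)) [^]\<^bsub>GL2\<^esub> (j div m) \<otimes>\<^bsub>GL2\<^esub> g [^]\<^bsub>GL2\<^esub> (l * (j mod m))"
      by (simp add: k j GL2.nat_pow_pow GL2.nat_pow_mult g)
    then have "x = g [^]\<^bsub>GL2\<^esub> (l * (j mod m))"
      by (simp add: gl g)
    then show "x \<in> (\<lambda>j. g [^]\<^bsub>GL2\<^esub> (l * j)) ` {..<m}" using m0 by simp
  qed
  then have "card R \<le> card ((\<lambda>j. g [^]\<^bsub>GL2\<^esub> (l * j)) ` {..<m})"
    by (intro card_mono) auto
  also have "\<dots> \<le> m" using card_image_le[of "{..<m}"] by simp
  finally have cR: "card R \<le> m" .
  have "Z = R" if Z: "subgroup Z GL2" "Z \<subseteq> S" "card Z = m" for Z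
  proof (rule card_seteq)
    show "Z \<subseteq> R"
    proof
      fix z assume z: "z \<in> Z"
      interpret Z: group "GL2\<lparr>carrier := Z\<rparr>" using Z(1) by (rule GL2.subgroup_imp_group)
      have "z [^]\<^bsub>GL2\<^esub> m = \<one>\<^bsub>GL2\<^esub>"
        using Z.pow_order_eq_1[of z] z Z(3) GL2.nat_pow_consistent[of z m Z] by (simp add: order_def)
      then show "z \<in> R" using z Z(2) by (auto simp: R_def)
    qed
  qed (use cR Z(3) in auto)
  from this[OF X] this[OF Y] show ?thesis using card by (simp add: m_def)
qed

text \<open>A generator \<open>g\<close> cannot be scalar, because there are too few scalars. So the cycle, being
  contained in the centraliser of \<open>g\<close>, lies in the algebra generated by \<open>g\<close>. This algebra has only
  \<open>q\<^sup>2\<close> elements, and by its order the cycle exhausts the nonzero ones. Hence all of these are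
  invertible and \<open>g\<close> has no eigenvalue.\<close>
lemma singer_cycle_alg:
  fixes S :: "('a::{field,finite}^2^2) set"
  assumes "singer_cycle S"
  shows "\<exists>g. anisotropic g \<and> S = alg g - {0} \<and> S = {g [^]\<^bsub>GL2\<^esub> k | k::nat. True}"
proof -
  have S: "subgroup S GL2" and cyc: "cyclic_group (GL2\<lparr>carrier := S\<rparr>)"
    and cS: "card S = CARD('a)\<^sup>2 - 1"
    using assms by (auto simp: singer_cycle_def)
  interpret S: group "GL2\<lparr>carrier := S\<rparr>" using S by (rule GL2.subgroup_imp_group)
  obtain g where g: "g \<in> S" "subgroup_generated (GL2\<lparr>carrier := S\<rparr>) {g} = GL2\<lparr>carrier := S\<rparr>"
    using cyc by (auto simp: cyclic_group_def)
  have "S = generate (GL2\<lparr>carrier := S\<rparr>) {g}"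
    using arg_cong[OF g(2), of carrier] g(1) by (simp add: carrier_subgroup_generated)
  also have "\<dots> = {g [^]\<^bsub>GL2\<lparr>carrier := S\<rparr>\<^esub> k | k. k \<in> (UNIV :: nat set)}"
    using g(1) by (intro S.generate_pow_on_finite_carrier) auto
  finally have gen: "S = {g [^]\<^bsub>GL2\<^esub> k | k::nat. True}"
    by (simp flip: GL2.nat_pow_consistent)
  have "card {0, 1 :: 'a} \<le> CARD('a)" by (intro card_mono) auto
  then have q: "CARD('a) \<ge> 2" by simp
  have ns: "\<not> scalar2 g"
  proof
    assume "scalar2 g"
    then obtain c where c: "g = mat c" by (auto simp: scalar2_def)
    have "g [^]\<^bsub>GL2\<^esub> k \<in> range mat" for k :: nat
    proof (induction k)
      case (Suc k)
      then obtain d where "g [^]\<^bsub>GL2\<^esub> k = mat d" by blast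
      then have "g [^]\<^bsub>GL2\<^esub> Suc k = mat (d * c)"
        by (simp add: GL2_simps c) (simp add: mat2_simps)
      then show ?case by simp
    qed (simp add: GL2_simps)
    then have "S \<subseteq> mat ` (UNIV - {0})"
    proof -
      have "mat 0 \<notin> S" using subgroup_GL2D(1)[OF S, of "mat 0"] by (auto simp: invertible_det_nz mat2_simps)
      then show ?thesis using \<open>\<And>k. g [^]\<^bsub>GL2\<^esub> k \<in> range mat\<close> gen by force
    qed
    then have "card S \<le> card (mat ` (UNIV - {0 :: 'a}) :: ('a^2^2) set)" by (intro card_mono) auto
    also have "\<dots> \<le> card (UNIV - {0 :: 'a})" by (intro card_image_le) auto
    also have "\<dots> = CARD('a) - 1" by (simp add: card_Diff_subset)
    finally have "CARD('a)\<^sup>2 - 1 \<le> CARD('a) - 1" using cS by simp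
    moreover have "CARD('a) * 2 \<le> CARD('a)\<^sup>2" using q by (simp add: power2_eq_square)
    ultimately show False using q by linarith
  qed
  have "S \<subseteq> alg g - {0}"
  proof
    fix x assume x: "x \<in> S"
    have "x ** g = g ** x"
      using S.cyclic_imp_abelian_group[OF cyc] x g(1) comm_groupE(4)[of "GL2\<lparr>carrier := S\<rparr>" x g]
      by (simp add: GL2_simps)
    moreover have "x \<noteq> 0"
      using subgroup_GL2D(1)[OF S x] by (auto simp: invertible_det_nz mat2_simps)
    ultimately show "x \<in> alg g - {0}" using commuting_imp_alg[OF ns] by blast
  qed
  moreover have "card (alg g - {0}) \<le> card S"
  proof -
    have "alg g = (\<lambda>(x, y). mat x + mat y ** g) ` UNIV" by (auto simp: alg_def)
    then have "card (alg g) \<le> card (UNIV :: ('a \<times> 'a) set)" by (metis card_image_le finite)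
    moreover have "0 \<in> alg g" using mat_in_alg[of 0 g] by (simp add: mat_def zero_vec_def)
    ultimately show ?thesis by (simp add: cS power2_eq_square)
  qed
  ultimately have Seq: "S = alg g - {0}" by (intro card_seteq) auto
  have "anisotropic g"
    unfolding anisotropic_def
  proof
    fix c
    have "g - mat c \<noteq> 0" using ns by (auto simp: scalar2_def)
    then have "g - mat c \<in> S" using alg_diff[OF alg_self mat_in_alg] Seq by blast
    then show "det (g - mat c) \<noteq> 0" using subgroup_GL2D(1)[OF S] invertible_det_nz by blast
  qed
  then show ?thesis using Seq gen by blast
qed

text \<open>The field \<^term>\<open>alg g\<close> contains an element \<open>e\<close> with the characteristic polynomial of
  \<open>b\<close>. A matrix conjugating \<open>b\<close> to \<open>e\<close> maps the centraliser of \<open>b\<close> to that of \<open>e\<close>, which is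
  the whole field.\<close>
lemma conjugate_into_alg:
  fixes g :: "'a::{field,finite}^2^2"
  assumes "anisotropic g" "b \<in> B" "anisotropic b" "\<And>x. x \<in> B \<Longrightarrow> x ** b = b ** x"
  shows "\<exists>P Q. P ** Q = mat 1 \<and> Q ** P = mat 1 \<and> (\<forall>x\<in>B. P ** x ** Q \<in> alg g)"
proof -
  obtain e where e: "e \<in> alg g" "trace e = trace b" "det e = det b"
    using alg_realises_invariants[OF assms(1,3)] by blast
  have ae: "anisotropic e"
    using assms(3) e(2,3) by (simp add: anisotropic_def det_minus_mat)
  have ne: "\<not> scalar2 e" using anisotropic_not_scalar[OF ae] .
  obtain P where P: "invertible P" "P ** b = e ** P"
    using similar_if_same_invariants[OF assms(3) ae] e(2,3) by metis
  obtain Q where Q: "P ** Q = mat 1" "Q ** P = mat 1" using invertible_obtain_inverse[OF P(1)] .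
  have "P ** x ** Q \<in> alg g" if x: "x \<in> B" for x
  proof -
    have bQ: "b ** Q = Q ** e"
    proof -
      have "b ** Q = Q ** (P ** b) ** Q" by (simp add: Q matrix_mul_assoc)
      also have "\<dots> = Q ** e ** (P ** Q)" by (simp add: P(2) matrix_mul_assoc)
      finally show ?thesis by (simp add: Q)
    qed
    have "(P ** x ** Q) ** e = P ** x ** (Q ** e)" by (simp add: matrix_mul_assoc)
    also have "\<dots> = P ** (x ** b) ** Q" by (simp add: matrix_mul_assoc flip: bQ)
    also have "\<dots> = (P ** b) ** x ** Q" by (simp add: assms(4)[OF x] matrix_mul_assoc)
    also have "\<dots> = e ** (P ** x ** Q)" by (simp add: P(2) matrix_mul_assoc)
    finally have "P ** x ** Q \<in> alg e" using commuting_imp_alg[OF ne] by blast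
    then show ?thesis using alg_subset[OF e(1)] by blast
  qed
  then show ?thesis using Q by blast
qed

text \<open>The power of \<open>s0\<close> by the odd part of the group order has an order dividing \<open>4\<close>, since \<open>8\<close>
  does not divide the group order; and odd powers stay outside \<open>S\<close>, since squares lie in \<open>S\<close>.\<close>
lemma ex_four_torsion_outside:
  assumes H: "subgroup H (GL2 :: ('a::{field,finite}^2^2) monoid)" and S: "subgroup S GL2"
    and cf: "cube_free_group (GL2\<lparr>carrier := H\<rparr>)"
    and sq: "\<And>h. h \<in> H \<Longrightarrow> h ** h \<in> S"
    and s0: "s0 \<in> H" "s0 \<notin> S"
  shows "\<exists>s\<in>H. s \<notin> S \<and> (s ** s) ** (s ** s) = mat 1"
proof -
  interpret H: group "GL2\<lparr>carrier := H\<rparr>" using H by (rule GL2.subgroup_imp_group)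
  define m where "m = card H"
  have "H \<noteq> {}" using s0 by blast
  then have m0: "m \<noteq> 0" by (simp add: m_def)
  obtain r where r: "m = 2 ^ multiplicity 2 m * r" "odd r"
    using multiplicity_decompose'[of m 2] m0 by (auto simp: mult.commute)
  define a where "a = multiplicity 2 m"
  have "\<not> 2 ^ 3 dvd m" 
    using cf[unfolded cube_free_group_def, rule_format, OF two_is_prime_nat] by (simp add: m_def)
  moreover have "2 ^ a dvd m" using r(1) by (metis a_def dvd_triv_left)
  ultimately have "\<not> 3 \<le> a" using le_imp_power_dvd[of 3 a "2::nat"] dvd_trans by blast
  then have "a \<le> 2" by simp
  then have "(2::nat) ^ a dvd 2 ^ 2" by (rule le_imp_power_dvd)
  then obtain b where "(2::nat) ^ 2 = 2 ^ a * b" by (rule dvdE)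
  then have b: "4 = 2 ^ a * b" by simp
  define s where "s = s0 [^]\<^bsub>GL2\<^esub> r"
  have s0c: "s0 \<in> carrier GL2" using subgroup.mem_carrier[OF H s0(1)] .
  have "s0 [^]\<^bsub>GL2\<^esub> m = \<one>\<^bsub>GL2\<^esub>"
    using H.pow_order_eq_1[of s0] s0(1) GL2.nat_pow_consistent[of s0 m H] by (simp add: order_def m_def)
  then have "s [^]\<^bsub>GL2\<^esub> (4::nat) = \<one>\<^bsub>GL2\<^esub>"
  proof -
    have "m * b = (2 ^ a * r) * b" using r(1)[folded a_def] by simp
    also have "\<dots> = r * 4" unfolding b by (simp add: ac_simps)
    finally have "r * 4 = m * b" by simp
    then have "s [^]\<^bsub>GL2\<^esub> (4::nat) = (s0 [^]\<^bsub>GL2\<^esub> m) [^]\<^bsub>GL2\<^esub> b"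
      by (simp add: s_def GL2.nat_pow_pow s0c)
    then show ?thesis using \<open>s0 [^]\<^bsub>GL2\<^esub> m = \<one>\<^bsub>GL2\<^esub>\<close> by simp
  qed
  then have "(s ** s) ** (s ** s) = mat 1"
    by (simp add: numeral_eq_Suc GL2_simps matrix_mul_assoc)
  moreover have "s \<in> H"
    using H.nat_pow_closed[of s0 r] s0(1) GL2.nat_pow_consistent[of s0 r H] by (simp add: s_def)
  moreover have "s \<notin> S"
  proof
    assume sS: "s \<in> S"
    obtain j where j: "r = Suc (2 * j)" using r(2) by (auto elim: oddE)
    interpret S: group "GL2\<lparr>carrier := S\<rparr>" using S by (rule GL2.subgroup_imp_group)
    define z where "z = (s0 ** s0) [^]\<^bsub>GL2\<^esub> j"
    have z: "z \<in> S"
      using S.nat_pow_closed[of "s0 ** s0" j] sq[OF s0(1)] GL2.nat_pow_consistent[of "s0 ** s0" j S]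
      by (simp add: z_def)
    have "s0 [^]\<^bsub>GL2\<^esub> (2::nat) = s0 ** s0"
      by (simp add: numeral_eq_Suc GL2_simps)
    then have "z = s0 [^]\<^bsub>GL2\<^esub> (2 * j)"
      unfolding z_def by (simp flip: GL2.nat_pow_pow[OF s0c])
    then have "s = z ** s0"
      unfolding s_def j by (simp add: GL2_simps)
    moreover obtain z' where "z' \<in> S" "z' ** z = mat 1" using subgroup_GL2D(4)[OF S z] by blast
    ultimately have "s0 = z' ** s" "z' \<in> S" by (simp_all add: matrix_mul_assoc)
    then show False using subgroup_GL2D(3)[OF S _ sS] s0(2) by blast
  qed
  ultimately show ?thesis by blast
qed

section \<open>Subgroups normalising a Singer cycle\<close>

text \<open>Multiplication by \<^term>\<open>h\<close> is semilinear over the field \<^term>\<open>alg g\<close> with respect to its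
  conjugation; this is how an element of the normaliser outside the Singer cycle acts.\<close>
definition semilinear :: "'a::field^2^2 \<Rightarrow> 'a^2^2 \<Rightarrow> bool" where
  "semilinear g h \<longleftrightarrow> (\<forall>Z\<in>alg g. h ** Z = adj2 Z ** h)"

lemma semilinear_swap:
  assumes "semilinear g h" "Z \<in> alg g"
  shows "h ** adj2 Z = Z ** h"
  using assms(1)[unfolded semilinear_def, rule_format, OF alg_adj2[OF assms(2)]]
  by (simp add: adj2_adj2)

lemma semilinear_mult:
  assumes "\<not> scalar2 g" "semilinear g h" "semilinear g h'"
  shows "h ** h' \<in> alg g"
proof -
  have "h' ** g = adj2 g ** h'"
    using assms(3) alg_self[of g] by (simp add: semilinear_def)
  then have "(h ** h') ** g = h ** (adj2 g ** h')"
    by (simp flip: matrix_mul_assoc)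
  also have "\<dots> = g ** (h ** h')"
    by (simp add: semilinear_swap[OF assms(2) alg_self] matrix_mul_assoc)
  finally show ?thesis using commuting_imp_alg[OF assms(1)] by blast
qed

lemma semilinear_inverse:
  assumes "semilinear g h" "h ** h' = mat 1" "h' ** h = mat 1"
  shows "semilinear g h'"
  unfolding semilinear_def
proof
  fix Z assume Z: "Z \<in> alg g"
  have "h' ** Z = h' ** (Z ** h) ** h'" by (simp add: assms(2) flip: matrix_mul_assoc)
  also have "\<dots> = (h' ** h) ** adj2 Z ** h'"
    by (simp add: matrix_mul_assoc flip: semilinear_swap[OF assms(1) Z])
  finally show "h' ** Z = adj2 Z ** h'" by (simp add: assms(3))
qed

text \<open>An element of the normaliser sends \<^term>\<open>g\<close> to a conjugate of it inside the field
  \<^term>\<open>alg g\<close>, and the only candidates are \<^term>\<open>g\<close> and its algebraic conjugate.\<close>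
lemma normalizer_semilinear:
  assumes "anisotropic g" "subgroup S GL2" "S = alg g - {0}" "h \<in> normalizer GL2 S"
  shows "h \<in> S \<or> semilinear g h"
proof -
  have S: "S \<subseteq> carrier GL2" using subgroup.subset[OF assms(2)] .
  have h: "invertible h" "conj_subgroup h S = S"
    using assms(4) S by (auto simp: normalizer_def stabilizer_def conj_subgroup_def GL2_simps)
  obtain h' where h': "h ** h' = mat 1" "h' ** h = mat 1"
    using invertible_obtain_inverse[OF h(1)] .
  have ns: "\<not> scalar2 g" using anisotropic_not_scalar[OF assms(1)] .
  have "g \<in> S" using assms(3) alg_self ns by (auto simp: scalar2_iff)
  then have "h ** g ** h' \<in> S" using h(2) unfolding conj_subgroup_eq_image[OF h'] by blast
  then have "h ** g ** h' \<in> alg g" using assms(3) by blast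
  moreover have "h ** g = (h ** g ** h') ** h" by (simp add: h' flip: matrix_mul_assoc)
  ultimately have "h \<in> alg g \<or> semilinear g h"
    using conjugate_in_alg[OF assms(1) h(1) alg_self _ _ ns] unfolding semilinear_def by blast
  moreover have "h \<noteq> 0" using h(1) by (auto simp: invertible_det_nz mat2_simps)
  ultimately show ?thesis using assms(3) by blast
qed

text \<open>A Singer cycle with a chosen generator, seen as the unit group of a quadratic field
  extension inside the matrix algebra.\<close>
locale singer_generator =
  fixes g :: "'a::{field,finite}^2^2" and S :: "('a^2^2) set"
  assumes aniso: "anisotropic g"
    and S_eq: "S = alg g - {0}"
    and S_subgroup: "subgroup S GL2"
    and S_powers: "S = {g [^]\<^bsub>GL2\<^esub> k | k::nat. True}"
begin

lemma not_scalar: "\<not> scalar2 g"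
  using anisotropic_not_scalar[OF aniso] .

lemma S_commute: "x \<in> S \<Longrightarrow> y \<in> S \<Longrightarrow> x ** y = y ** x"
  using alg_commute S_eq by blast

lemma invertible_alg_in_S: "x \<in> alg g \<Longrightarrow> invertible x \<Longrightarrow> x \<in> S"
  using S_eq by (auto simp: invertible_det_nz det_2)

lemma normal_abelian_conjugate_into_S:
  assumes K: "primitive_subgroup K" and B: "B \<subseteq> K"
    and comm: "\<And>x y. x \<in> B \<Longrightarrow> y \<in> B \<Longrightarrow> x ** y = y ** x"
    and normal: "\<And>k x. k \<in> K \<Longrightarrow> x \<in> B \<Longrightarrow> \<exists>y\<in>B. k ** x = y ** k"
    and b: "b \<in> B" "\<not> scalar2 b"
  shows "\<exists>P Q. P ** Q = mat 1 \<and> Q ** P = mat 1 \<and> (\<lambda>x. P ** x ** Q) ` B \<subseteq> S"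
proof -
  have "anisotropic b"
    using normal_abelian_subgroup_anisotropic[OF K B comm normal b] .
  then obtain P Q where P: "P ** Q = mat 1" "Q ** P = mat 1"
    "\<And>x. x \<in> B \<Longrightarrow> P ** x ** Q \<in> alg g"
    using conjugate_into_alg[OF aniso b(1) _ comm[OF _ b(1)]] by blast
  have "P ** x ** Q \<in> S" if x: "x \<in> B" for x
  proof -
    have "invertible x" using K B x subgroup_GL2D(1)
      by (auto simp: primitive_subgroup_def irreducible_subgroup_def)
    moreover have "invertible P" "invertible Q" using P(1,2) by (auto simp: invertible_def)
    ultimately have "invertible (P ** x ** Q)" by (intro invertible_mult)
    then show ?thesis using invertible_alg_in_S P(3)[OF x] by blast
  qed
  then show ?thesis using P(1,2) by blast
qed

text \<open>An abelian primitive group is its own normal abelian subgroup, hence conjugate to a subgroup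
  of the cyclic group \<^term>\<open>S\<close>, where only one subgroup has the given order.\<close>
lemma abelian_primitive_conjugate:
  fixes H K :: "('a^2^2) set"
  assumes H: "primitive_subgroup H" "\<And>x y. x \<in> H \<Longrightarrow> y \<in> H \<Longrightarrow> x ** y = y ** x"
    and K: "primitive_subgroup K" "\<And>x y. x \<in> K \<Longrightarrow> y \<in> K \<Longrightarrow> x ** y = y ** x"
    and card: "card K = card H"
  shows "\<exists>y. invertible y \<and> K = conj_subgroup y H"
proof -
  have into: "\<exists>P. invertible P \<and> subgroup (conj_subgroup P L) GL2 \<and> conj_subgroup P L \<subseteq> S
      \<and> card (conj_subgroup P L) = card L"
    if L: "primitive_subgroup L" "\<And>x y. x \<in> L \<Longrightarrow> y \<in> L \<Longrightarrow> x ** y = y ** x" for L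
  proof -
    have sL: "subgroup L GL2" and iL: "irreducible_subgroup L"
      using L(1) by (auto simp: primitive_subgroup_def irreducible_subgroup_def)
    obtain b where b: "b \<in> L" "\<not> scalar2 b" using irreducible_not_all_scalar[OF iL] by blast
    have "\<exists>y\<in>L. k ** x = y ** k" if "k \<in> L" "x \<in> L" for k x using L(2)[OF that] that by blast
    then obtain P Q where P: "P ** Q = mat 1" "Q ** P = mat 1" "(\<lambda>x. P ** x ** Q) ` L \<subseteq> S"
      using normal_abelian_conjugate_into_S[OF L(1) subset_refl L(2) _ b] by blast
    have iP: "invertible P" "invertible Q" using P(1,2) by (auto simp: invertible_def)
    have eq: "conj_subgroup P L = (\<lambda>x. P ** x ** Q) ` L"
      by (rule conj_subgroup_eq_image[OF P(1,2)])
    have "subgroup ((\<lambda>x. P ** x ** Q) ` L) GL2"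
      using subgroup_GL2D(1)[OF sL] iP
      by (intro subgroup_hom_image[OF sL] invertible_mult conjugation_mult[OF P(2)])
    moreover have "inj_on (\<lambda>x. P ** x ** Q) L"
      by (intro inj_onI) (metis invertible_mult_cancel iP)
    ultimately show ?thesis using iP(1) P(3) eq card_image by metis
  qed
  obtain P where P: "invertible P" "subgroup (conj_subgroup P H) GL2" "conj_subgroup P H \<subseteq> S"
      "card (conj_subgroup P H) = card H"
    using into[OF H] by metis
  obtain R where R: "invertible R" "subgroup (conj_subgroup R K) GL2" "conj_subgroup R K \<subseteq> S"
      "card (conj_subgroup R K) = card K"
    using into[OF K] by metis
  have "conj_subgroup R K = conj_subgroup P H"
    using subgroup_card_eq_imp_eq[OF S_powers S_subgroup R(2,3) P(2,3)] R(4) P(4) card by simp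
  then show ?thesis using conj_subgroup_eq_imp[OF R(1) P(1)] by blast
qed

end

locale singer_normalised = singer_generator g S
  for g :: "'a::{field,finite}^2^2" and S :: "('a^2^2) set" +
  fixes H :: "('a^2^2) set"
  assumes H_subgroup: "subgroup H GL2"
    and S_or_semilinear: "\<And>h. h \<in> H \<Longrightarrow> h \<in> S \<or> semilinear g h"
begin

lemma invertible_H: "x \<in> H \<Longrightarrow> invertible x"
  using subgroup_GL2D(1)[OF H_subgroup] .

lemma mult_H: "x \<in> H \<Longrightarrow> y \<in> H \<Longrightarrow> x ** y \<in> H"
  using subgroup_GL2D(3)[OF H_subgroup] .

lemma alg_in_S: "x \<in> H \<Longrightarrow> x \<in> alg g \<Longrightarrow> x \<in> S"
  using invertible_alg_in_S invertible_H by blast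

lemma square_in_S: "h \<in> H \<Longrightarrow> h ** h \<in> S"
  using S_or_semilinear subgroup_GL2D(3)[OF S_subgroup] semilinear_mult[OF not_scalar]
    alg_in_S[OF mult_H] by metis

lemma coset_outside_S:
  assumes s: "s \<in> H" "s \<notin> S" and h: "h \<in> H" "h \<notin> S"
  shows "\<exists>x\<in>H \<inter> S. h = s ** x"
proof -
  obtain s' where s': "s' \<in> H" "s ** s' = mat 1" "s' ** s = mat 1"
    using subgroup_GL2D(4)[OF H_subgroup s(1)] by blast
  have "semilinear g s'" "semilinear g h"
    using S_or_semilinear s h semilinear_inverse[OF _ s'(2,3)] by blast+
  then have "s' ** h \<in> H \<inter> S"
    using semilinear_mult[OF not_scalar] alg_in_S mult_H s'(1) h(1) by blast
  moreover have "h = s ** (s' ** h)" by (simp add: matrix_mul_assoc s')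
  ultimately show ?thesis by blast
qed

lemma S_part_normal:
  assumes h: "h \<in> H" and x: "x \<in> H \<inter> S"
  shows "\<exists>y\<in>H \<inter> S. h ** x = y ** h"
proof -
  obtain h' where h': "h' \<in> H" "h ** h' = mat 1" using subgroup_GL2D(4)[OF H_subgroup h] by blast
  have "\<exists>y\<in>alg g. h ** x = y ** h"
    using S_or_semilinear[OF h] x S_eq alg_adj2 alg_commute unfolding semilinear_def by blast
  then obtain y where y: "y \<in> alg g" "h ** x = y ** h" by blast
  have "y = h ** x ** h'" using y(2) h'(2) by (simp flip: matrix_mul_assoc)
  then have "y \<in> H" using mult_H h h'(1) x by simp
  then show ?thesis using y alg_in_S by blast
qed

lemma commuting_nonscalar_in_S:
  assumes "s \<in> H" "a \<in> H \<inter> S" "\<not> scalar2 a" "s ** a = a ** s"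
  shows "s \<in> S"
proof -
  have "s \<in> alg a" using commuting_imp_alg[OF assms(3,4)] .
  then show ?thesis using alg_subset assms(1,2) S_eq alg_in_S by blast
qed

text \<open>If every element of \<^term>\<open>H \<inter> S\<close> were scalar, \<^term>\<open>H\<close> would be an extension of a central
  subgroup by a group of order at most two, hence abelian.\<close>
lemma nonabelian_nonscalar_in_S:
  assumes nonab: "\<not> (\<forall>x\<in>H. \<forall>y\<in>H. x ** y = y ** x)" and s: "s \<in> H" "s \<notin> S"
  shows "\<exists>a\<in>H \<inter> S. \<not> scalar2 a"
proof (rule ccontr)
  assume "\<not> (\<exists>a\<in>H \<inter> S. \<not> scalar2 a)"
  then have cent: "x ** y = y ** x" if "x \<in> H \<inter> S" for x y
    using that mat_commute unfolding scalar2_def by metis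
  have "x ** y = y ** x" if xy: "x \<in> H" "y \<in> H" for x y
  proof -
    consider "x \<in> H \<inter> S" | "y \<in> H \<inter> S"
      | u v where "x = s ** u" "y = s ** v" "u \<in> H \<inter> S" "v \<in> H \<inter> S"
      using coset_outside_S[OF s] xy by blast
    then show ?thesis
    proof cases
      case 3
      have "s ** u ** (s ** v) = s ** (u ** s) ** v" by (simp add: matrix_mul_assoc)
      also have "\<dots> = s ** s ** (u ** v)" using cent[OF 3(3), of s] by (simp add: matrix_mul_assoc)
      also have "\<dots> = s ** (s ** v) ** u" using cent[OF 3(3), of v] by (simp add: matrix_mul_assoc)
      also have "\<dots> = s ** (v ** s) ** u" using cent[OF 3(4), of s] by simp
      finally show ?thesis using 3 by (simp add: matrix_mul_assoc)
    qed (use cent in metis)+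
  qed
  then show False using nonab by blast
qed

text \<open>Let \<open>\<psi>\<close> embed \<^term>\<open>H\<close> so that \<^term>\<open>H \<inter> S\<close> is mapped onto itself, and put
  \<open>t = \<psi> s\<close>. Both \<open>s\<close> and \<open>t\<close> are semilinear, so \<open>t = s ** e\<close> with \<open>e\<close> in the field, and
  \<open>t ** t\<close> is \<open>s ** s\<close> times the norm \<open>det e\<close>. The two squares are roots of \<open>x\<^sup>2 = 1\<close> in a field and
  have the same order, so they agree and \<open>e\<close> has norm one. Writing \<open>e\<close> as a quotient
  \<open>adj2 y / y\<close> by Hilbert 90 yields \<open>y ** s = t ** y\<close>, while \<open>y\<close> centralises
  \<^term>\<open>H \<inter> S\<close>; so \<open>y\<close> conjugates \<^term>\<open>H\<close> onto its image.\<close>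
lemma embedding_image_conjugate:
  fixes \<psi> :: "'a^2^2 \<Rightarrow> 'a^2^2"
  assumes a: "a \<in> H \<inter> S" "\<not> scalar2 a"
    and s: "s \<in> H" "s \<notin> S" "(s ** s) ** (s ** s) = mat 1"
    and hom: "\<And>x y. x \<in> H \<Longrightarrow> y \<in> H \<Longrightarrow> \<psi> (x ** y) = \<psi> x ** \<psi> y"
    and inj: "inj_on \<psi> H"
    and inv: "\<And>x. x \<in> H \<Longrightarrow> invertible (\<psi> x)"
    and img: "\<psi> ` (H \<inter> S) = H \<inter> S"
  shows "\<exists>y. invertible y \<and> conj_subgroup y H = \<psi> ` H"
proof -
  define t where "t = \<psi> s"
  have HS: "x \<in> alg g" if "x \<in> H \<inter> S" for x using that S_eq by blast
  have semi_s: "semilinear g s" using S_or_semilinear[OF s(1)] s(2) by blast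
  have one: "\<psi> (mat 1) = mat 1"
  proof -
    have "\<psi> (mat 1) ** \<psi> (mat 1) = \<psi> (mat 1) ** mat 1"
      using hom[OF subgroup_GL2D(2) subgroup_GL2D(2), OF H_subgroup H_subgroup] by simp
    then show ?thesis
      using invertible_mult_cancel(1)[OF inv[OF subgroup_GL2D(2)[OF H_subgroup]]] by blast
  qed
  have semi_t: "semilinear g t"
  proof -
    obtain a' where a': "a' \<in> H \<inter> S" "\<psi> a' = a" using a(1) img by (metis imageE)
    obtain y where y: "y \<in> H \<inter> S" "s ** a' = y ** s" using S_part_normal[OF s(1) a'(1)] by blast
    have "t ** a = \<psi> y ** t"
      using hom[OF s(1), of a'] hom[OF _ s(1), of y] a' y by (simp add: t_def)
    moreover have "\<psi> y \<in> alg g" using y(1) img HS by blast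
    moreover have "invertible t" unfolding t_def by (rule inv[OF s(1)])
    ultimately have "t \<in> alg g \<or> semilinear g t"
      using conjugate_in_alg[OF aniso _ HS[OF a(1)] _ _ a(2)] unfolding semilinear_def by blast
    moreover have "t \<notin> alg g"
    proof
      assume "t \<in> alg g"
      moreover have "\<psi> a \<in> alg g" using a(1) img HS by blast
      ultimately have "t ** \<psi> a = \<psi> a ** t" by (rule alg_commute)
      then have "\<psi> (s ** a) = \<psi> (a ** s)"
        using hom[OF s(1), of a] hom[OF _ s(1), of a] a(1) by (simp add: t_def)
      then have "s ** a = a ** s" using inj_onD[OF inj] mult_H s(1) a(1) by blast
      then show False using commuting_nonscalar_in_S[OF s(1) a] s(2) by blast
    qed
    ultimately show ?thesis by blast
  qed
  have tt: "t ** t = s ** s"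
  proof -
    have pm: "x = mat 1 \<or> x = - mat 1" if x: "x \<in> alg g" "x ** x = mat 1" for x
    proof -
      have "(x - mat 1) ** (x + mat 1) = x ** x - mat 1"
        by (simp add: mat2_simps algebra_simps)
      then have "(x - mat 1) ** (x + mat 1) = 0" using x(2) by simp
      then have "x - mat 1 = 0 \<or> x + mat 1 = 0"
        using alg_integral[OF aniso alg_diff[OF x(1) mat_in_alg] alg_add[OF x(1) mat_in_alg]]
        by blast
      then show ?thesis by (simp add: eq_neg_iff_add_eq_0)
    qed
    have ss: "s ** s \<in> alg g" and tt: "t ** t \<in> alg g"
      using semilinear_mult[OF not_scalar] semi_s semi_t by blast+
    have ssH: "s ** s \<in> H" using mult_H[OF s(1) s(1)] .
    have h: "\<psi> (s ** s) = t ** t" unfolding t_def by (rule hom[OF s(1) s(1)])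
    have "(t ** t) ** (t ** t) = mat 1"
      using hom[OF ssH ssH] s(3) one h by simp
    then have "t ** t = mat 1 \<or> t ** t = - mat 1" using pm[OF tt] by blast
    moreover have "s ** s = mat 1 \<or> s ** s = - mat 1" using pm[OF ss s(3)] .
    moreover have "s ** s = mat 1 \<longleftrightarrow> t ** t = mat 1"
      using inj_onD[OF inj _ ssH subgroup_GL2D(2)[OF H_subgroup]] h one by metis
    ultimately show ?thesis by auto
  qed
  obtain s' where s': "s ** s' = mat 1" "s' ** s = mat 1"
    using subgroup_GL2D(4)[OF H_subgroup s(1)] by blast
  define e where "e = s' ** t"
  have t: "t = s ** e" by (simp add: e_def matrix_mul_assoc s')
  have e: "e \<in> alg g"
    unfolding e_def
    using semilinear_mult[OF not_scalar semilinear_inverse[OF semi_s s'] semi_t] .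
  have "det e = 1"
  proof -
    have "t ** t = s ** (e ** s) ** e" by (simp add: t matrix_mul_assoc)
    also have "\<dots> = s ** (s ** adj2 e) ** e" by (simp add: semilinear_swap[OF semi_s e])
    also have "\<dots> = (s ** s) ** mat (det e)"
      by (simp add: mult_adj2(2) flip: matrix_mul_assoc)
    finally have "(s ** s) ** mat (det e) = (s ** s) ** mat 1" using tt by simp
    then have "mat (det e) = (mat 1 :: 'a^2^2)"
      using invertible_mult_cancel(1) invertible_H mult_H[OF s(1) s(1)] by blast
    then show ?thesis by (simp add: mat2_simps)
  qed
  then obtain y where y: "y \<in> alg g" "y \<noteq> 0" "adj2 y = e ** y"
    using hilbert_90[OF aniso e] by blast
  have yi: "invertible y" using alg_det_nonzero[OF aniso y(1,2)] invertible_det_nz by blast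
  obtain y' where y': "y ** y' = mat 1" "y' ** y = mat 1" using invertible_obtain_inverse[OF yi] .
  have ys: "y ** s = t ** y"
    by (simp add: y(3) t matrix_mul_assoc flip: semilinear_swap[OF semi_s y(1)])
  have conjA: "y ** x ** y' = x" if "x \<in> alg g" for x
    using alg_commute[OF y(1) that] y' by (simp flip: matrix_mul_assoc)
  have conjs: "y ** (s ** x) ** y' = t ** x" if "x \<in> alg g" for x
  proof -
    have "y ** (s ** x) ** y' = t ** (y ** x ** y')" by (simp add: ys matrix_mul_assoc)
    then show ?thesis by (simp add: conjA[OF that])
  qed
  have "(\<lambda>x. y ** x ** y') ` H = \<psi> ` H"
  proof (intro equalityI image_subsetI)
    fix h assume h: "h \<in> H"
    show "y ** h ** y' \<in> \<psi> ` H"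
    proof (cases "h \<in> S")
      case True
      then have "y ** h ** y' \<in> H \<inter> S" using conjA h HS by simp
      then show ?thesis using img by blast
    next
      case False
      then obtain x where x: "x \<in> H \<inter> S" "h = s ** x" using coset_outside_S[OF s(1,2) h] by blast
      obtain x' where x': "x' \<in> H \<inter> S" "\<psi> x' = x" using x(1) img by (metis imageE)
      have "y ** h ** y' = \<psi> (s ** x')"
        using conjs[OF HS[OF x(1)]] hom[OF s(1), of x'] x' x(2) by (simp add: t_def)
      then show ?thesis using mult_H[OF s(1)] x'(1) by blast
    qed
    show "\<psi> h \<in> (\<lambda>x. y ** x ** y') ` H"
    proof (cases "h \<in> S")
      case True
      then have p: "\<psi> h \<in> H \<inter> S" using h img by blast
      then have "\<psi> h = y ** \<psi> h ** y'" using conjA[OF HS] by simp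
      then show ?thesis using p by blast
    next
      case False
      then obtain x where x: "x \<in> H \<inter> S" "h = s ** x" using coset_outside_S[OF s(1,2) h] by blast
      have p: "\<psi> x \<in> H \<inter> S" using x(1) img by blast
      have "\<psi> h = y ** (s ** \<psi> x) ** y'"
        using conjs[OF HS[OF p]] hom[OF s(1), of x] x by (simp add: t_def)
      then show ?thesis using mult_H[OF s(1)] p by blast
    qed
  qed
  then show ?thesis using yi conj_subgroup_eq_image[OF y'] by metis
qed

text \<open>The image of \<^term>\<open>H \<inter> S\<close> in \<^term>\<open>K\<close> is a normal abelian subgroup with a nonscalar
  element, so it can be conjugated into \<^term>\<open>S\<close>, where its order identifies it with
  \<^term>\<open>H \<inter> S\<close>. What remains is to match the other coset.\<close>
lemma nonabelian_primitive_conjugate: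
  assumes cf: "cube_free_group (GL2\<lparr>carrier := H\<rparr>)"
    and nonab: "\<not> (\<forall>x\<in>H. \<forall>y\<in>H. x ** y = y ** x)"
    and K: "primitive_subgroup K"
    and hom: "\<And>x y. x \<in> H \<Longrightarrow> y \<in> H \<Longrightarrow> \<phi> (x ** y) = \<phi> x ** \<phi> y"
    and bij: "bij_betw \<phi> H K"
  shows "\<exists>y. invertible y \<and> K = conj_subgroup y H"
proof -
  have K_subgroup: "subgroup K GL2"
    using K by (simp add: primitive_subgroup_def irreducible_subgroup_def)
  have \<phi>K: "\<phi> x \<in> K" if "x \<in> H" for x using bij that by (auto simp: bij_betw_def)
  have inj: "inj_on \<phi> H" using bij by (simp add: bij_betw_def)
  define A where "A = H \<inter> S"
  have AH: "x \<in> H" if "x \<in> A" for x using that by (simp add: A_def)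
  have A: "subgroup A GL2" unfolding A_def using GL2.subgroups_Inter_pair[OF H_subgroup S_subgroup] .
  obtain s0 where s0: "s0 \<in> H" "s0 \<notin> S" using nonab S_commute by blast
  obtain s where s: "s \<in> H" "s \<notin> S" "(s ** s) ** (s ** s) = mat 1"
    using ex_four_torsion_outside[OF H_subgroup S_subgroup cf square_in_S s0] by blast
  obtain a where a: "a \<in> A" "\<not> scalar2 a"
    using nonabelian_nonscalar_in_S[OF nonab s0] unfolding A_def by blast
  have nsa: "\<not> scalar2 (\<phi> a)"
  proof
    assume "scalar2 (\<phi> a)"
    then have "\<phi> s ** \<phi> a = \<phi> a ** \<phi> s" using mat_commute unfolding scalar2_def by metis
    then have "\<phi> (s ** a) = \<phi> (a ** s)" using hom s(1) AH[OF a(1)] by simp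
    then have "s ** a = a ** s" using inj_onD[OF inj] mult_H s(1) AH[OF a(1)] by blast
    then show False using commuting_nonscalar_in_S[OF s(1) _ a(2)] a(1) s(2) A_def by blast
  qed
  have "\<exists>P Q. P ** Q = mat 1 \<and> Q ** P = mat 1 \<and> (\<lambda>x. P ** x ** Q) ` \<phi> ` A \<subseteq> S"
  proof (rule normal_abelian_conjugate_into_S[OF K])
    show "\<phi> ` A \<subseteq> K" using \<phi>K AH by blast
    show "x ** y = y ** x" if xy: "x \<in> \<phi> ` A" "y \<in> \<phi> ` A" for x y
    proof -
      obtain u v where uv: "u \<in> A" "v \<in> A" "x = \<phi> u" "y = \<phi> v" using xy by blast
      then have "u ** v = v ** u" using S_commute by (simp add: A_def)
      then show ?thesis using hom uv AH by metis
    qed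
    show "\<exists>y\<in>\<phi> ` A. k ** x = y ** k" if kx: "k \<in> K" "x \<in> \<phi> ` A" for k x
    proof -
      obtain h u where hu: "h \<in> H" "u \<in> A" "k = \<phi> h" "x = \<phi> u"
        using kx bij by (auto simp: bij_betw_def)
      obtain w where w: "w \<in> A" "h ** u = w ** h"
        using S_part_normal[OF hu(1)] hu(2) unfolding A_def by blast
      have "k ** x = \<phi> w ** k" using hom hu w AH by metis
      then show ?thesis using w(1) by blast
    qed
    show "\<phi> a \<in> \<phi> ` A" using a(1) by blast
    show "\<not> scalar2 (\<phi> a)" by fact
  qed
  then obtain P Q where P: "P ** Q = mat 1" "Q ** P = mat 1"
    "(\<lambda>x. P ** x ** Q) ` \<phi> ` A \<subseteq> S" by blast
  have iP: "invertible P" "invertible Q" using P(1,2) by (auto simp: invertible_def)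
  define \<psi> where "\<psi> = (\<lambda>x. P ** \<phi> x ** Q)"
  have hom': "\<psi> (x ** y) = \<psi> x ** \<psi> y" if "x \<in> H" "y \<in> H" for x y
    unfolding \<psi>_def hom[OF that] by (rule conjugation_mult[OF P(2)])
  have inj': "inj_on \<psi> H"
  proof (rule inj_onI)
    fix x y assume xy: "x \<in> H" "y \<in> H" "\<psi> x = \<psi> y"
    then have "\<phi> x = \<phi> y" unfolding \<psi>_def using invertible_mult_cancel iP by metis
    then show "x = y" using inj_onD[OF inj] xy by blast
  qed
  have inv': "invertible (\<psi> x)" if "x \<in> H" for x
    unfolding \<psi>_def using subgroup_GL2D(1)[OF K_subgroup \<phi>K[OF that]] iP by (intro invertible_mult)
  have img: "\<psi> ` A = A"
  proof (rule subgroup_card_eq_imp_eq[OF S_powers S_subgroup])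
    show "subgroup (\<psi> ` A) GL2"
      by (rule subgroup_hom_image[OF A]) (use hom' inv' AH in auto)
    show "\<psi> ` A \<subseteq> S" using P(3) by (auto simp: \<psi>_def)
    show "card (\<psi> ` A) = card A"
      by (rule card_image) (rule inj_on_subset[OF inj'], simp add: A_def)
  qed (use A in \<open>auto simp: A_def\<close>)
  obtain y where y: "invertible y" "conj_subgroup y H = \<psi> ` H"
    using embedding_image_conjugate[OF _ a(2) s hom' inj' inv'] a(1) img
    unfolding A_def by blast
  have "conj_subgroup P K = \<psi> ` H"
    using bij unfolding conj_subgroup_eq_image[OF P(1,2)] \<psi>_def by (auto simp: bij_betw_def)
  then have "conj_subgroup P K = conj_subgroup y H" using y(2) by simp
  then show ?thesis using conj_subgroup_eq_imp[OF iP(1) y(1)] by blast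
qed

end

section \<open>Counting the conjugacy classes\<close>

theorem theorem1p4:
  fixes p q k m :: nat
    and S H :: "('a::{field,finite}^2^2) set"
  assumes "prime p"
    and "k \<ge> 1" and "q = p ^ k"
    and "CARD('a) = q"
    and "singer_cycle S"
    and "subgroup H GL2" and "H \<subseteq> normalizer GL2 S"
    and "cube_free_group (GL2\<lparr>carrier := H\<rparr>)"
    and "primitive_subgroup H"
    and "card H = m"
    and "\<not> p dvd m"
  shows "N_pr m H = 1"
proof -
  have S: "subgroup S GL2" using assms(5) by (simp add: singer_cycle_def)
  obtain g where g: "anisotropic g" and Sg: "S = alg g - {0}"
    and gen: "S = {g [^]\<^bsub>GL2\<^esub> k | k::nat. True}"
    using singer_cycle_alg[OF assms(5)] by blast
  interpret singer_generator g S using g Sg S gen by (rule singer_generator.intro)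
  interpret singer_normalised g S H
    using assms(6,7) normalizer_semilinear[OF g S Sg]
    by (intro singer_normalised.intro singer_normalised_axioms.intro singer_generator_axioms) blast+
  let ?E = "{K :: ('a^2^2) set. primitive_subgroup K \<and> card K = m \<and>
    GL2\<lparr>carrier := K\<rparr> \<cong> GL2\<lparr>carrier := H\<rparr>}"
  have "\<exists>y. invertible y \<and> K = conj_subgroup y H" if K_in: "K \<in> ?E" for K
  proof -
    have prK: "primitive_subgroup K" and cK: "card K = m"
      and iso: "GL2\<lparr>carrier := K\<rparr> \<cong> GL2\<lparr>carrier := H\<rparr>" using K_in by auto
    have K: "subgroup K GL2"
      using prK by (simp add: primitive_subgroup_def irreducible_subgroup_def)
    obtain \<phi> where \<phi>: "\<phi> \<in> iso (GL2\<lparr>carrier := H\<rparr>) (GL2\<lparr>carrier := K\<rparr>)"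
      using group.iso_sym[OF GL2.subgroup_imp_group[OF K] iso] by (auto simp: is_iso_def)
    have hom: "\<phi> (x ** y) = \<phi> x ** \<phi> y" if "x \<in> H" "y \<in> H" for x y
      using \<phi> that by (auto simp: iso_def hom_def GL2_simps)
    have bij: "bij_betw \<phi> H K" using \<phi> by (simp add: iso_def)
    show ?thesis
    proof (cases "\<forall>x\<in>H. \<forall>y\<in>H. x ** y = y ** x")
      case True
      have commK: "x ** y = y ** x" if xy: "x \<in> K" "y \<in> K" for x y
      proof -
        obtain x' y' where "x' \<in> H" "y' \<in> H" "x = \<phi> x'" "y = \<phi> y'"
          using bij xy by (auto simp: bij_betw_def)
        then show ?thesis using True hom by metis
      qed
      show ?thesis
        by (rule abelian_primitive_conjugate[OF assms(9) _ prK])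
          (use True commK cK assms(10) in auto)
    next
      case False
      show ?thesis
        using nonabelian_primitive_conjugate[OF assms(8) False prK hom bij] .
    qed
  qed
  moreover have "H \<in> ?E"
    using assms(9,10) by (simp add: iso_refl)
  ultimately have "orbits GL2 ?E conj_subgroup = {orbit GL2 conj_subgroup H}"
    by (intro orbits_singleton)
  then show ?thesis by (simp add: N_pr_def)
qed

end
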